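(* Consider the two-color urn model described in the context, in either of the two cases "$m_A>m_B$" or "$m_A=m_B$" defined there. Assume that $$E[N_{n+1}\,|\,\mathcal{F}_n]\to N \quad\text{and}\quad E[N_{n+1}^2\,|\,\mathcal{F}_n]\to Q\qquad\text{almost surely},$$ where $N$ and $Q$ are finite, strictly positive random variables. Set $N_{A,n}=\sum_{j=1}^nX_j$ and $N_{B,n}=\sum_{j=1}^n(N_j-X_j)$. Then, in both cases: (i) $\widehat{\mu}_n=\frac1n\sum_{j=1}^n N_j$ and $\widehat{q}_{N,n}=\frac1n\sum_{j=1}^n N_j^2$ are strongly consistent estimators of $N$ and $Q$, i.e. $\widehat{\mu}_n\to N$ and $\widehat{q}_{N,n}\to Q$ almost surely. (ii) The random variables $$\widehat{m}_{A,n}=\frac{\sum_{j=1}^n A_jX_j}{N_{A,n}},\qquad \widehat{m}_{B,n}=\frac{\sum_{j=1}^n B_j(N_j-X_j)}{N_{B,n}}$$ are strongly consistent estimators of $m_A$ and $m_B$, i.e. they converge almost surely to $m_A$ and $m_B$, respectively. (iii) If in addition $E[A_n^2]\to q_A$ and $E[B_n^2]\to q_B$, then $$\widehat{q}_{A,n}=\frac{\sum_{j=1}^n A_j^2X_j}{N_{A,n}}\qquad\text{and}\qquad \widehat{q}_{B,n}=\frac{\sum_{j=1}^n B_j^2(N_j-X_j)}{N_{B,n}}$$ converge almost surely to $q_A$ and $q_B$, respectively. (iv) If $E[A_nB_n]\to q_{AB}$ and $P(N=1)<1$, then $$\widehat{q}_{AB,n}=\frac{\sum_{j=1}^n A_jB_jX_j(N_j-X_j)}{\sum_{j=1}^nX_j(N_j-X_j)}\to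 q_{AB}\qquad\text{almost surely on } \{N>1\}.$$
   Context: Urn model. An urn initially contains $a\ge 1$ balls of color A and $b\ge 1$ balls of color B ($a,b$ integers). On a probability space $(\Omega,\mathcal{A},P)$ there are random variables $N_n,X_n,A_n,B_n$, $n\ge1$. At each time $n\ge 1$, $N_n$ balls are drawn simultaneously without replacement, $X_n$ of them are of color A, and they are returned to the urn together with $A_nX_n$ new balls of color A and $B_n(N_n-X_n)$ new balls of color B. Define $$H_n=a+\sum_{j=1}^n A_jX_j,\qquad K_n=b+\sum_{j=1}^n B_j(N_j-X_j),\qquad S_n=H_n+K_n$$ (numbers of A balls, of B balls, and of all balls after step $n$; $H_0=a$, $K_0=b$). Let $\mathcal{F}_0$ be the trivial $\sigma$-field and $\mathcal{F}_n=\sigma(N_1,X_1,A_1,B_1,\dots,N_n,X_n,A_n,B_n)$ for $n\ge1$. For each $n\ge1$ it is assumed that: (A1) the conditional distribution of $N_n$ given $\mathcal{F}_{n-1}$ is concentrated on $\{1,\dots,S_{n-1}\}$ (and is otherwise arbitrary); (A2) the conditional distribution of $X_n$ given $\mathcal{F}_{n-1}\vee\sigma(N_n)$ is hypergeometric with parameters $N_n,S_{n-1},H_{n-1}$, i.e. the number of color-A balls in a sample without replacement of size $N_n$ from $S_{n-1}$ balls of which $H_{n-1}$ are of color A; (A3) the random vector $[A_n,B_n]$ takes values in $\{1,2,\dots\}^2$ and is independent of $\mathcal{F}_{n-1}\vee\sigma(N_n,X_n)$ (its joint distribution is otherwise arbitrary and may depend on $n$). Standing assumption: there is an integer constant $C$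 with $A_n\vee B_n\vee N_n\le C$ for all $n$. Put $m_{A,n}=E[A_n]$, $m_{B,n}=E[B_n]$, and assume $m_{A,n}\to m_A<+\infty$, $m_{B,n}\to m_B<+\infty$. The two cases are: Case $m_A>m_B$: $m_A>m_B$ and $\sum_n |m_{A,n+1}m_B-m_A m_{B,n+1}|/n<+\infty$. Case $m_A=m_B$: $m_{A,n}=m_{B,n}$ for each $n$ (hence $m_A=m_B\in[1,+\infty)$). Ratios are considered once their denominators are nonzero. *)

theory Defs
  imports "HOL-Probability.Probability"
begin

definition hypergeometric_pmf :: "nat \<Rightarrow> nat \<Rightarrow> nat \<Rightarrow> nat pmf" where
  "hypergeometric_pmf n s h =
     map_pmf (\<lambda>T. card (T \<inter> {..<h})) (pmf_of_set {T. T \<subseteq> {..<s} \<and> card T = n})"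

lemma pmf_hypergeometric:
  assumes "n \<le> s" "h \<le> s"
  shows "pmf (hypergeometric_pmf n s h) k =
    (if k \<le> n then real (h choose k) * real ((s - h) choose (n - k)) / real (s choose n) else 0)"
proof -
  let ?U = "{T. T \<subseteq> {..<s} \<and> card T = n}"
  let ?V = "?U \<inter> (\<lambda>T. card (T \<inter> {..<h})) -` {k}"
  have fin: "finite ?U" by (rule finite_subset[of _ "Pow {..<s}"]) auto
  have cardU: "card ?U = s choose n" by (simp add: n_subsets)
  hence ne: "?U \<noteq> {}" using assms by (metis binomial_eq_0_iff card.empty not_le)
  have *: "pmf (hypergeometric_pmf n s h) k = real (card ?V) / real (s choose n)"
    using cardU unfolding hypergeometric_pmf_def pmf_map
    by (subst measure_pmf_of_set[OF ne fin]) (simp add: Int_commute)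
  have split: "card T = card (T \<inter> {..<h}) + card (T - {..<h})" if "T \<subseteq> {..<s}" for T
    by (metis that card_Int_Diff finite_lessThan finite_subset)
  show ?thesis
  proof (cases "k \<le> n")
    case False
    have "?V = {}"
    proof (rule ccontr)
      assume "?V \<noteq> {}"
      then obtain T where "T \<subseteq> {..<s}" "card T = n" "card (T \<inter> {..<h}) = k" by auto
      with split[of T] False show False by linarith
    qed
    thus ?thesis using * False by simp
  next
    case True
    let ?P = "{T. T \<subseteq> {..<h} \<and> card T = k}" and ?R = "{T. T \<subseteq> {h..<s} \<and> card T = n - k}"
    have "bij_betw (\<lambda>T. (T \<inter> {..<h}, T - {..<h})) ?V (?P \<times> ?R)"
    proof (rule bij_betwI[where g = "\<lambda>(T, T'). T \<union> T'"])
      show "(\<lambda>T. (T \<inter> {..<h}, T - {..<h})) \<in> ?V \<rightarrow> ?P \<times> ?R"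
      proof (clarify, intro conjI SigmaI CollectI)
        fix T assume T: "T \<subseteq> {..<s}" "n = card T" "k = card (T \<inter> {..<h})"
        show "T - {..<h} \<subseteq> {h..<s}" using T(1) by (fastforce simp: not_less)
        show "card (T - {..<h}) = card T - card (T \<inter> {..<h})" using split[OF T(1)] by linarith
      qed simp_all
      show "(\<lambda>(T, T'). T \<union> T') \<in> ?P \<times> ?R \<rightarrow> ?V"
      proof (clarify, intro IntI CollectI conjI)
        fix T T' assume a: "T \<subseteq> {..<h}" "k = card T" "T' \<subseteq> {h..<s}" "card T' = n - card T"
        show sub: "T \<union> T' \<subseteq> {..<s}" using a assms by fastforce
        have e: "(T \<union> T') \<inter> {..<h} = T" using a by fastforce
        have "(T \<union> T') - {..<h} = T'" using a by fastforce
        with split[OF sub] e a True show "card (T \<union> T') = n" by simp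
        show "T \<union> T' \<in> (\<lambda>T. card (T \<inter> {..<h})) -` {card T}" by (simp add: e)
      qed
    next
      fix y assume "y \<in> ?P \<times> ?R"
      then obtain T T' where y: "y = (T, T')" "T \<subseteq> {..<h}" "T' \<subseteq> {h..<s}" by auto
      have "(T \<union> T') \<inter> {..<h} = T" "(T \<union> T') - {..<h} = T'" using y by fastforce+
      thus "((\<lambda>(T, T'). T \<union> T') y \<inter> {..<h}, (\<lambda>(T, T'). T \<union> T') y - {..<h}) = y"
        using y by simp
    qed auto
    hence "card ?V = card ?P * card ?R"
      unfolding card_cartesian_product[symmetric] by (rule bij_betw_same_card)
    also have "\<dots> = (h choose k) * ((s - h) choose (n - k))" by (simp add: n_subsets)
    finally show ?thesis using * True by simp
  qed
qed

definition gen_sigma :: "'w measure \<Rightarrow> ('w \<Rightarrow> nat) set \<Rightarrow> 'w measure" where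
  "gen_sigma M \<Y> = sigma (space M) {Y -` S \<inter> space M | Y S. Y \<in> \<Y>}"

text \<open>
  In all sequences the entry with index 0 is unused. The subtraction of naturals in the
  definition of \<open>urn_K\<close> never truncates, up to a null set: the hypergeometric law
  assumed below forces \<open>X j \<le> N j\<close> almost surely.
\<close>

definition urn_H :: "nat \<Rightarrow> (nat \<Rightarrow> 'w \<Rightarrow> nat) \<Rightarrow> (nat \<Rightarrow> 'w \<Rightarrow> nat) \<Rightarrow> nat \<Rightarrow> 'w \<Rightarrow> nat" where
  "urn_H a X A n \<omega> = a + (\<Sum>j=1..n. A j \<omega> * X j \<omega>)"

definition urn_K ::
  "nat \<Rightarrow> (nat \<Rightarrow> 'w \<Rightarrow> nat) \<Rightarrow> (nat \<Rightarrow> 'w \<Rightarrow> nat) \<Rightarrow> (nat \<Rightarrow> 'w \<Rightarrow> nat) \<Rightarrow> nat \<Rightarrow> 'w \<Rightarrow> nat" where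
  "urn_K b N X B n \<omega> = b + (\<Sum>j=1..n. B j \<omega> * (N j \<omega> - X j \<omega>))"

definition urn_vars ::
  "(nat \<Rightarrow> 'w \<Rightarrow> nat) \<Rightarrow> (nat \<Rightarrow> 'w \<Rightarrow> nat) \<Rightarrow> (nat \<Rightarrow> 'w \<Rightarrow> nat) \<Rightarrow> (nat \<Rightarrow> 'w \<Rightarrow> nat)
    \<Rightarrow> nat \<Rightarrow> ('w \<Rightarrow> nat) set" where
  "urn_vars N X A B n = (\<Union>j\<in>{1..n}. {N j, X j, A j, B j})"

definition urn_F ::
  "'w measure \<Rightarrow> (nat \<Rightarrow> 'w \<Rightarrow> nat) \<Rightarrow> (nat \<Rightarrow> 'w \<Rightarrow> nat) \<Rightarrow> (nat \<Rightarrow> 'w \<Rightarrow> nat) \<Rightarrow> (nat \<Rightarrow> 'w \<Rightarrow> nat)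
    \<Rightarrow> nat \<Rightarrow> 'w measure" where
  "urn_F M N X A B n = gen_sigma M (urn_vars N X A B n)"

locale urn_model = prob_space M for M :: "'w measure" +
  fixes a b :: nat
    and N X A B :: "nat \<Rightarrow> 'w \<Rightarrow> nat"
  assumes init: "a \<ge> 1" "b \<ge> 1"
    and rv: "\<And>n. n \<ge> 1 \<Longrightarrow> N n \<in> measurable M (count_space UNIV)"
            "\<And>n. n \<ge> 1 \<Longrightarrow> X n \<in> measurable M (count_space UNIV)"
            "\<And>n. n \<ge> 1 \<Longrightarrow> A n \<in> measurable M (count_space UNIV)"
            "\<And>n. n \<ge> 1 \<Longrightarrow> B n \<in> measurable M (count_space UNIV)"
    and N_concentrated:
      "\<And>n. AE \<omega> in M.
         real_cond_exp M (urn_F M N X A B n)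
           (indicator {\<omega> \<in> space M. N (Suc n) \<omega> \<in> {1..urn_H a X A n \<omega> + urn_K b N X B n \<omega>}}) \<omega> = 1"
    and X_hypergeometric:
      "\<And>n k. AE \<omega> in M.
         real_cond_exp M (gen_sigma M (urn_vars N X A B n \<union> {N (Suc n)}))
           (indicator {\<omega> \<in> space M. X (Suc n) \<omega> = k}) \<omega>
         = pmf (hypergeometric_pmf (N (Suc n) \<omega>)
                  (urn_H a X A n \<omega> + urn_K b N X B n \<omega>) (urn_H a X A n \<omega>)) k"
    and AB_pos: "\<And>n. n \<ge> 1 \<Longrightarrow> AE \<omega> in M. A n \<omega> \<ge> 1 \<and> B n \<omega> \<ge> 1"
    and AB_indep:
      "\<And>n. indep_set (sets (gen_sigma M {A (Suc n), B (Suc n)}))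
              (sets (gen_sigma M (urn_vars N X A B n \<union> {N (Suc n), X (Suc n)})))"
    and bounded:
      "\<exists>C. \<forall>n\<ge>1. AE \<omega> in M. A n \<omega> \<le> C \<and> B n \<omega> \<le> C \<and> N n \<omega> \<le> C"

text \<open>The term with index 0 of the series is zero, since division by zero yields zero.\<close>

definition urn_case_greater ::
  "'w measure \<Rightarrow> (nat \<Rightarrow> 'w \<Rightarrow> nat) \<Rightarrow> (nat \<Rightarrow> 'w \<Rightarrow> nat) \<Rightarrow> real \<Rightarrow> real \<Rightarrow> bool" where
  "urn_case_greater M A B mA mB \<longleftrightarrow> mA > mB \<and>
     summable (\<lambda>n. \<bar>(\<integral>\<omega>. real (A (Suc n) \<omega>) \<partial>M) * mB - mA * (\<integral>\<omega>. real (B (Suc n) \<omega>) \<partial>M)\<bar> / real n)"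

definition urn_case_equal ::
  "'w measure \<Rightarrow> (nat \<Rightarrow> 'w \<Rightarrow> nat) \<Rightarrow> (nat \<Rightarrow> 'w \<Rightarrow> nat) \<Rightarrow> bool" where
  "urn_case_equal M A B \<longleftrightarrow>
     (\<forall>n\<ge>1. (\<integral>\<omega>. real (A n \<omega>) \<partial>M) = (\<integral>\<omega>. real (B n \<omega>) \<partial>M))"

end

theory Submission
  imports Defs
begin

text \<open>
  Everything follows from one strong law with random normalisation. Suppose that \<open>w\<^sub>j \<ge> 0\<close> is
  known before the centred variable \<open>\<xi>\<^sub>j\<close> is observed and that the conditional second moment
  of \<open>\<xi>\<^sub>j\<close> is at most \<open>c w\<^sub>j\<close>. With \<open>W\<^sub>j = 1 + w\<^sub>0 + \<dots> + w\<^sub>j\<close> the martingale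
  with increments \<open>\<xi>\<^sub>j / W\<^sub>j\<close> is bounded in \<open>L\<^sup>2\<close>, because \<open>w\<^sub>j / W\<^sub>j\<^sup>2\<close> is dominated by a
  telescoping sum; hence it converges almost surely, and Kronecker's lemma gives
  \<open>(\<xi>\<^sub>0 + \<dots> + \<xi>\<^sub>n) / W\<^sub>n \<rightarrow> 0\<close> wherever \<open>W\<^sub>n \<rightarrow> \<infinity>\<close>.

  Taking \<open>\<xi>\<^sub>j = Y\<^sub>j - w\<^sub>j\<close> with \<open>w\<^sub>j\<close> the conditional expectation of a bounded \<open>Y\<^sub>j \<ge> 0\<close>
  yields (i), and also the divergence of the sums of \<open>X\<^sub>j\<close>, of \<open>N\<^sub>j - X\<^sub>j\<close> and, on \<open>N > 1\<close>, of
  \<open>X\<^sub>j (N\<^sub>j - X\<^sub>j)\<close>: their hypergeometric conditional means are at least of order \<open>1 / j\<close>,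
  respectively \<open>(N\<^sub>j - 1) / j\<close>, since the urn grows at most linearly and always contains both
  colours. Taking for \<open>\<xi>\<^sub>j\<close> a centred function of \<open>(A\<^sub>j, B\<^sub>j)\<close> times one of these three
  weights yields (ii), (iii) and (iv).
\<close>

subsection \<open>Weighted averages\<close>

text \<open>Toeplitz averaging: a fixed initial block contributes the constant \<open>K\<close>,
  which the diverging total weight swamps, and every later term is within \<open>e / 2\<close> of
  the limit.\<close>

lemma weighted_cesaro:
  fixes w s :: "nat \<Rightarrow> real"
  assumes nonneg: "\<And>n. 0 \<le> w n"
    and div: "filterlim (\<lambda>n. \<Sum>j<n. w j) at_top sequentially"
    and lim: "s \<longlonglongrightarrow> l"
  shows "(\<lambda>n. (\<Sum>j<n. w j * s j) / (\<Sum>j<n. w j)) \<longlonglongrightarrow> l"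
proof (rule LIMSEQ_I)
  fix e :: real assume e: "e > 0"
  obtain m where m: "\<And>n. n \<ge> m \<Longrightarrow> \<bar>s n - l\<bar> < e / 2"
    using LIMSEQ_D[OF lim, of "e / 2"] e by auto
  define K where "K = (\<Sum>j<m. w j * \<bar>s j - l\<bar>)"
  have "K \<ge> 0" unfolding K_def by (intro sum_nonneg mult_nonneg_nonneg nonneg) auto
  \<comment> \<open>The threshold is chosen to give \<open>K < ?W * (e / 2)\<close>; the extra 1
    makes this strict and, as \<open>K \<ge> 0\<close>, also keeps the denominator positive.\<close>
  obtain n0 where n0: "\<And>n. n \<ge> n0 \<Longrightarrow> (\<Sum>j<n. w j) \<ge> 2 * K / e + 1"
    using div by (auto simp: filterlim_at_top eventually_sequentially)
  show "\<exists>no. \<forall>n\<ge>no. norm ((\<Sum>j<n. w j * s j) / (\<Sum>j<n. w j) - l) < e"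
  proof (intro exI[of _ "max m n0"] allI impI)
    fix n assume n: "max m n0 \<le> n"
    let ?W = "\<Sum>j<n. w j"
    have "2 * K / e \<ge> 0" using e \<open>K \<ge> 0\<close> by simp
    hence W: "?W > 2 * K / e" "?W > 0" using n0[of n] n by linarith+
    have split: "{..<n} = {..<m} \<union> {m..<n}" using n by auto
    have "\<bar>\<Sum>j<n. w j * (s j - l)\<bar> \<le> (\<Sum>j<n. w j * \<bar>s j - l\<bar>)"
      by (rule order_trans[OF sum_abs]) (simp add: abs_mult nonneg)
    also have "\<dots> = K + (\<Sum>j\<in>{m..<n}. w j * \<bar>s j - l\<bar>)"
      unfolding split K_def by (subst sum.union_disjoint) auto
    also have "(\<Sum>j\<in>{m..<n}. w j * \<bar>s j - l\<bar>) \<le> (\<Sum>j\<in>{m..<n}. w j * (e / 2))"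
      using m nonneg by (intro sum_mono mult_left_mono) (auto simp: less_imp_le)
    also have "\<dots> \<le> (\<Sum>j<n. w j * (e / 2))"
      by (rule sum_mono2) (use nonneg e in auto)
    also have "\<dots> = ?W * (e / 2)" by (simp add: sum_distrib_right)
    finally have "\<bar>\<Sum>j<n. w j * (s j - l)\<bar> \<le> K + ?W * (e / 2)" by simp
    also have "K < ?W * (e / 2)" using W e by (simp add: field_simps)
    finally have *: "\<bar>\<Sum>j<n. w j * (s j - l)\<bar> < ?W * e" by (simp add: mult.commute)
    have "(\<Sum>j<n. w j * s j) / ?W - l = (\<Sum>j<n. w j * (s j - l)) / ?W"
      using W by (simp add: field_simps sum_subtractf sum_distrib_left)
    thus "norm ((\<Sum>j<n. w j * s j) / ?W - l) < e"
      using * W by (simp add: abs_divide pos_divide_less_eq mult.commute)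
  qed
qed

text \<open>Summation by parts writes the partial sums of \<open>x\<close> as
  \<open>V n * s n\<close> minus a weighted sum of the convergent \<open>s\<close>; after division
  by the total weight both terms tend to the same \<open>l\<close>. The normaliser starts from 1, so
  it stays positive even while all weights are still zero.\<close>

lemma kronecker_weighted:
  fixes w x :: "nat \<Rightarrow> real"
  assumes nonneg: "\<And>n. 0 \<le> w n"
    and div: "filterlim (\<lambda>n. \<Sum>j<n. w j) at_top sequentially"
    and sm: "summable (\<lambda>n. x n / (1 + (\<Sum>j<Suc n. w j)))"
  shows "(\<lambda>n. (\<Sum>j<n. x j) / (\<Sum>j<n. w j)) \<longlonglongrightarrow> 0"
proof -
  define V where "V n = 1 + (\<Sum>j<n. w j)" for n
  define s where "s n = (\<Sum>j<n. x j / V (Suc j))" for n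
  have V: "V n \<ge> 1" for n unfolding V_def by (simp add: sum_nonneg nonneg)
  obtain l where l: "s \<longlonglongrightarrow> l"
    using sm unfolding s_def V_def summable_def sums_def by auto
  \<comment> \<open>\<open>x n\<close> is \<open>V (Suc n)\<close> times the increment of
    \<open>s\<close>, and the increment of \<open>V\<close> is \<open>w n\<close>.\<close>
  have abel: "(\<Sum>j<n. x j) = V n * s n - (\<Sum>j<n. w j * s j)" for n
  proof (induction n)
    case (Suc n)
    have "V (Suc n) = V n + w n" by (simp add: V_def)
    moreover have "V (Suc n) * s (Suc n) = V (Suc n) * s n + x n"
      using V[of "Suc n"] by (simp add: s_def field_simps)
    ultimately show ?case using Suc by (simp add: algebra_simps)
  qed (simp add: s_def)
  have inv: "(\<lambda>n. 1 / (\<Sum>j<n. w j)) \<longlonglongrightarrow> 0"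
    by (rule tendsto_divide_0[OF tendsto_const filterlim_at_top_imp_at_infinity[OF div]])
  have "(\<lambda>n. (1 / (\<Sum>j<n. w j) + 1) * s n - (\<Sum>j<n. w j * s j) / (\<Sum>j<n. w j)) \<longlonglongrightarrow> (0 + 1) * l - l"
    by (intro tendsto_intros inv l weighted_cesaro nonneg div)
  moreover have "\<forall>\<^sub>F n in sequentially. (\<Sum>j<n. w j) > 0"
    using div by (simp add: filterlim_at_top_dense)
  hence "\<forall>\<^sub>F n in sequentially. (1 / (\<Sum>j<n. w j) + 1) * s n - (\<Sum>j<n. w j * s j) / (\<Sum>j<n. w j)
      = (\<Sum>j<n. x j) / (\<Sum>j<n. w j)"
    by eventually_elim (simp add: abel V_def field_simps)
  ultimately have "(\<lambda>n. (\<Sum>j<n. x j) / (\<Sum>j<n. w j)) \<longlonglongrightarrow> (0 + 1) * l - l"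
    by (rule Lim_transform_eventually)
  thus ?thesis by simp
qed

text \<open>With \<open>V\<close> the normaliser before \<open>w n\<close> is added, the new term is
  at most \<open>w n / (V * (V + w n))\<close>, which telescopes. The resulting bound 1 holds
  whatever the weights are, so it can be integrated over random ones.\<close>

lemma sum_weight_over_square_le_one:
  fixes w :: "nat \<Rightarrow> real"
  assumes nonneg: "\<And>n. 0 \<le> w n"
  shows "(\<Sum>j<n. w j / (1 + (\<Sum>i<Suc j. w i))\<^sup>2) \<le> 1 - 1 / (1 + (\<Sum>i<n. w i))"
proof (induction n)
  case (Suc n)
  define V where "V = 1 + (\<Sum>i<n. w i)"
  have V: "V \<ge> 1" unfolding V_def by (simp add: sum_nonneg nonneg)
  have "w n / (V + w n)\<^sup>2 \<le> w n / (V * (V + w n))"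
    unfolding power2_eq_square using V nonneg[of n]
    by (intro divide_left_mono mult_right_mono mult_pos_pos) auto
  also have "\<dots> = 1 / V - 1 / (V + w n)" using V nonneg[of n] by (simp add: field_simps)
  finally show ?case using Suc by (simp add: V_def add.assoc)
qed simp

text \<open>Stopping at the first passage of level \<open>e\<close> replaces the usual disjoint decomposition in the maximal inequality.\<close>

lemma stopped_sum_large:
  fixes d :: "nat \<Rightarrow> real" and k :: nat
  defines "T \<equiv> \<lambda>n. \<Sum>j\<in>{k..<n}. d j"
  assumes "k \<le> i" "i \<le> n" "\<bar>T i\<bar> \<ge> e"
  shows "\<bar>\<Sum>j\<in>{k..<n}. if \<forall>i\<in>{k..j}. \<bar>T i\<bar> < e then d j else 0\<bar> \<ge> e"
proof -
  let ?S = "\<lambda>n. \<Sum>j\<in>{k..<n}. if \<forall>i\<in>{k..j}. \<bar>T i\<bar> < e then d j else 0"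
  \<comment> \<open>The induction also tracks the phase before the passage, where the stopped sum is
    \<open>T n\<close>; afterwards it stays frozen at the value reached at the passage.\<close>
  have "((\<forall>i\<in>{k..n}. \<bar>T i\<bar> < e) \<longrightarrow> ?S n = T n) \<and> ((\<exists>i\<in>{k..n}. \<bar>T i\<bar> \<ge> e) \<longrightarrow> \<bar>?S n\<bar> \<ge> e)"
    if "k \<le> n" for n
    using that
  proof (induction n rule: dec_induct)
    case base
    then show ?case by (simp add: T_def)
  next
    case (step n)
    have T: "T (Suc n) = T n + d n" using step by (simp add: T_def)
    have iv: "{k..Suc n} = insert (Suc n) {k..n}" using step by auto
    show ?case
    proof (cases "\<forall>i\<in>{k..n}. \<bar>T i\<bar> < e")
      case True
      hence "?S (Suc n) = T (Suc n)" using step T by auto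
      thus ?thesis using True unfolding iv by (auto simp: not_le[symmetric])
    next
      case False
      hence "?S (Suc n) = ?S n" using step by auto
      moreover have "\<exists>i\<in>{k..n}. \<bar>T i\<bar> \<ge> e" using False by (auto simp: not_less)
      ultimately show ?thesis using step False unfolding iv by auto
    qed
  qed
  from this[of n] assms(2-) show ?thesis by auto
qed

subsection \<open>Almost sure convergence of square-integrable martingale series\<close>

lemma (in prob_space) integrable_AE_bounded:
  fixes f :: "'a \<Rightarrow> real"
  assumes "f \<in> borel_measurable M" "AE x in M. \<bar>f x\<bar> \<le> c"
  shows "integrable M f"
  using assms by (intro integrable_const_bound[of _ c]) auto

text \<open>A filtration, kept abstract because the strong laws are applied along three filtrations
  of the urn, taken just before the draw size, the drawn colours and the reinforcement are
  revealed.\<close>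

locale increasing_subalgebras = prob_space +
  fixes G :: "nat \<Rightarrow> 'a measure"
  assumes subalg: "\<And>n. subalgebra M (G n)"
    and sets_Suc: "\<And>n. sets (G n) \<subseteq> sets (G (Suc n))"
begin

lemma space_G [simp]: "space (G n) = space M"
  using subalg[of n] by (simp add: subalgebra_def)

lemma sets_mono: "m \<le> n \<Longrightarrow> sets (G m) \<subseteq> sets (G n)"
  by (rule lift_Suc_mono_le[of "\<lambda>n. sets (G n)"]) (use sets_Suc in auto)

lemma measurable_mono: "m \<le> n \<Longrightarrow> f \<in> measurable (G m) S \<Longrightarrow> f \<in> measurable (G n) S"
  using sets_mono[of m n] by (auto simp: measurable_def)

lemma measurable_M: "f \<in> measurable (G m) S \<Longrightarrow> f \<in> measurable M S"
  using subalg[of m] by (rule measurable_from_subalg)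

end

text \<open>That \<open>D n\<close> has conditional mean 0 given \<open>G n\<close> is encoded as
  orthogonality to integrable \<open>G n\<close>-measurable functions: both conditional expectations
  and independence supply it in this form. \<open>D n\<close> is revealed at time
  \<open>Suc n\<close>.\<close>

locale bounded_mart_diff = increasing_subalgebras +
  fixes D :: "nat \<Rightarrow> 'a \<Rightarrow> real" and c :: real
  assumes D_meas: "\<And>n. D n \<in> borel_measurable (G (Suc n))"
    and D_bound: "\<And>n. AE x in M. \<bar>D n x\<bar> \<le> c"
    and D_orth: "\<And>n U. U \<in> borel_measurable (G n) \<Longrightarrow> integrable M U \<Longrightarrow> (\<integral>x. U x * D n x \<partial>M) = 0"
begin

lemma D_meas_le: "Suc j \<le> n \<Longrightarrow> D j \<in> borel_measurable (G n)"
  using D_meas measurable_mono by blast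

lemma D_meas_M [measurable]: "D j \<in> borel_measurable M"
  using D_meas measurable_M by blast

text \<open>Pythagoras for a martingale transform: the factor \<open>T n * I n\<close> of each cross
  term is \<open>G n\<close>-measurable, so \<open>D_orth\<close> removes that term, and values of
  \<open>I j\<close> in [0, 1] only shrink the squares.\<close>

lemma second_moment_transform:
  assumes I_meas: "\<And>j. I j \<in> borel_measurable (G j)"
    and I_bd: "\<And>j x. 0 \<le> I j x \<and> I j x \<le> 1"
    and km: "k \<le> m"
  shows "(\<integral>x. (\<Sum>j\<in>{k..<m}. I j x * D j x)\<^sup>2 \<partial>M) \<le> (\<Sum>j\<in>{k..<m}. \<integral>x. (D j x)\<^sup>2 \<partial>M)"
proof -
  have [measurable]: "I j \<in> borel_measurable M" for j using I_meas measurable_M by blast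
  have Ia: "\<bar>I j x\<bar> \<le> 1" for j x using I_bd[of j x] by simp
  have ID: "AE x in M. \<bar>I j x * D j x\<bar> \<le> c" for j
    using D_bound[of j]
  proof eventually_elim
    case (elim x)
    show ?case using mult_mono[OF Ia[of j x] elim] by (simp add: abs_mult)
  qed
  have c0: "c \<ge> 0"
  proof -
    have "AE x in M. 0 \<le> c" using D_bound[of 0] by eventually_elim linarith
    thus ?thesis by simp
  qed
  define T where "T n x = (\<Sum>j\<in>{k..<n}. I j x * D j x)" for n x
  have [measurable]: "T n \<in> borel_measurable M" for n unfolding T_def by measurable
  have T_meas: "T n \<in> borel_measurable (G n)" for n
    unfolding T_def
    by (intro borel_measurable_sum borel_measurable_times)
       (auto intro: D_meas_le measurable_mono[OF _ I_meas])
  have T_bd: "AE x in M. \<bar>T n x\<bar> \<le> real n * c" for n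
  proof -
    have "AE x in M. \<forall>j. \<bar>I j x * D j x\<bar> \<le> c" using ID by (simp add: AE_all_countable)
    thus ?thesis
    proof eventually_elim
      case (elim x)
      have "\<bar>T n x\<bar> \<le> (\<Sum>j\<in>{k..<n}. \<bar>I j x * D j x\<bar>)" unfolding T_def by (rule sum_abs)
      also have "\<dots> \<le> (\<Sum>j\<in>{k..<n}. c)" using elim by (intro sum_mono) auto
      also have "\<dots> \<le> real n * c" using c0 by (simp add: mult_right_mono)
      finally show ?case .
    qed
  qed
  have prod_int: "integrable M (\<lambda>x. f x * g x)"
    if "f \<in> borel_measurable M" "g \<in> borel_measurable M" "AE x in M. \<bar>f x\<bar> \<le> r" "AE x in M. \<bar>g x\<bar> \<le> s"
    for f g :: "'a \<Rightarrow> real" and r s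
  proof (rule integrable_AE_bounded[of _ "r * s"])
    show "AE x in M. \<bar>f x * g x\<bar> \<le> r * s"
      using that(3,4) by eventually_elim (auto simp: abs_mult intro!: mult_mono)
  qed (use that in measurable)
  have "(\<integral>x. (T m x)\<^sup>2 \<partial>M) \<le> (\<Sum>j\<in>{k..<m}. \<integral>x. (D j x)\<^sup>2 \<partial>M)"
    using km
  proof (induction m rule: dec_induct)
    case base
    then show ?case by (simp add: T_def)
  next
    case (step n)
    have TS: "T (Suc n) x = T n x + I n x * D n x" for x using step by (simp add: T_def)
    have i1: "integrable M (\<lambda>x. (T n x)\<^sup>2)"
      unfolding power2_eq_square by (rule prod_int[OF _ _ T_bd T_bd]) auto
    have i2: "integrable M (\<lambda>x. (I n x * D n x)\<^sup>2)"
      unfolding power2_eq_square by (rule prod_int[OF _ _ ID ID]) auto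
    have U_int: "integrable M (\<lambda>x. T n x * I n x)"
      by (rule prod_int[OF _ _ T_bd, of _ _ 1]) (use Ia in auto)
    have i3: "integrable M (\<lambda>x. T n x * (I n x * D n x))"
      by (rule prod_int[OF _ _ T_bd ID]) auto
    have "(\<integral>x. (T n x * I n x) * D n x \<partial>M) = 0"
      by (rule D_orth[OF _ U_int]) (use T_meas I_meas in measurable)
    hence zero: "(\<integral>x. T n x * (I n x * D n x) \<partial>M) = 0" by (simp add: mult.assoc)
    have "(\<integral>x. (T (Suc n) x)\<^sup>2 \<partial>M)
        = (\<integral>x. (T n x)\<^sup>2 + (I n x * D n x)\<^sup>2 + 2 * (T n x * (I n x * D n x)) \<partial>M)"
      unfolding TS by (simp add: power2_sum mult.assoc)
    also have "\<dots> = (\<integral>x. (T n x)\<^sup>2 \<partial>M) + (\<integral>x. (I n x * D n x)\<^sup>2 \<partial>M)"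
      using i1 i2 i3 zero by simp
    also have "(\<integral>x. (I n x * D n x)\<^sup>2 \<partial>M) \<le> (\<integral>x. (D n x)\<^sup>2 \<partial>M)"
    proof (rule integral_mono[OF i2])
      show "integrable M (\<lambda>x. (D n x)\<^sup>2)"
        unfolding power2_eq_square by (rule prod_int[OF _ _ D_bound D_bound]) auto
      fix x
      have "(I n x)\<^sup>2 \<le> 1" using I_bd[of n x] by (simp add: power_le_one)
      thus "(I n x * D n x)\<^sup>2 \<le> (D n x)\<^sup>2"
        by (simp add: power_mult_distrib mult_left_le_one_le)
    qed
    finally show ?case using step by simp
  qed
  thus ?thesis by (simp add: T_def)
qed

text \<open>Kolmogorov's inequality. Stopping at the first passage is a transform by a predictable
  0-1 sequence, so the stopped sum obeys the second moment bound, and Markov's inequality applies to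
  its square at time \<open>m\<close>.\<close>

lemma maximal_inequality:
  assumes e: "e > 0" and km: "k \<le> m"
  shows "prob {x \<in> space M. \<exists>n\<in>{k..m}. \<bar>\<Sum>j\<in>{k..<n}. D j x\<bar> \<ge> e}
           \<le> (\<Sum>j\<in>{k..<m}. \<integral>x. (D j x)\<^sup>2 \<partial>M) / e\<^sup>2"
proof -
  \<comment> \<open>\<open>I j\<close> inspects partial sums up to \<open>i = j\<close>, hence only
    \<open>D l\<close> with \<open>l < j\<close>; this makes it \<open>G j\<close>-measurable and
    therefore predictable.\<close>
  define I where "I j x = (if \<forall>i\<in>{k..j}. \<bar>\<Sum>l\<in>{k..<i}. D l x\<bar> < e then 1 else 0 :: real)" for j x
  have I_meas: "I j \<in> borel_measurable (G j)" for j
  proof -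
    have "(\<lambda>x. \<Sum>l\<in>{k..<i}. D l x) \<in> borel_measurable (G j)" if "i \<le> j" for i
      by (intro borel_measurable_sum D_meas_le) (use that in auto)
    hence "Measurable.pred (G j) (\<lambda>x. \<forall>i\<in>{k..j}. \<bar>\<Sum>l\<in>{k..<i}. D l x\<bar> < e)"
      by (intro pred_intros_finite) (auto intro!: borel_measurable_pred_less)
    thus ?thesis unfolding I_def by measurable
  qed
  have [measurable]: "I j \<in> borel_measurable M" for j using I_meas measurable_M by blast
  define S where "S x = (\<Sum>j\<in>{k..<m}. I j x * D j x)" for x
  have [measurable]: "S \<in> borel_measurable M" unfolding S_def by measurable
  have "{x \<in> space M. \<exists>n\<in>{k..m}. \<bar>\<Sum>j\<in>{k..<n}. D j x\<bar> \<ge> e} \<subseteq> {x \<in> space M. (S x)\<^sup>2 \<ge> e\<^sup>2}"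
  proof safe
    fix x n assume "n \<in> {k..m}" "\<bar>\<Sum>j\<in>{k..<n}. D j x\<bar> \<ge> e"
    with stopped_sum_large[of k n m e "\<lambda>j. D j x"]
    have "e \<le> \<bar>S x\<bar>" by (auto simp: S_def I_def if_distrib[of "\<lambda>y. y * _"] cong: if_cong)
    thus "e\<^sup>2 \<le> (S x)\<^sup>2" using e by (metis abs_le_square_iff abs_of_pos)
  qed
  hence "prob {x \<in> space M. \<exists>n\<in>{k..m}. \<bar>\<Sum>j\<in>{k..<n}. D j x\<bar> \<ge> e} \<le> prob {x \<in> space M. (S x)\<^sup>2 \<ge> e\<^sup>2}"
    by (rule finite_measure_mono) measurable
  also have "\<dots> \<le> (\<integral>x. (S x)\<^sup>2 \<partial>M) / e\<^sup>2"
  proof (rule integral_Markov_inequality_measure[where A = "{}"])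
    show "integrable M (\<lambda>x. (S x)\<^sup>2)"
    proof (rule integrable_AE_bounded)
      have "AE x in M. \<forall>j. \<bar>D j x\<bar> \<le> c" using D_bound by (simp add: AE_all_countable)
      thus "AE x in M. \<bar>(S x)\<^sup>2\<bar> \<le> (\<Sum>j\<in>{k..<m}. c)\<^sup>2"
      proof eventually_elim
        case (elim x)
        have "\<bar>S x\<bar> \<le> (\<Sum>j\<in>{k..<m}. \<bar>I j x * D j x\<bar>)" unfolding S_def by (rule sum_abs)
        also have "\<dots> \<le> (\<Sum>j\<in>{k..<m}. c)"
          by (intro sum_mono) (use elim order_trans[OF abs_ge_zero] in \<open>auto simp: I_def abs_mult\<close>)
        finally show ?case by (metis abs_ge_zero abs_power2 power2_abs power_mono)
      qed
    qed measurable
  qed (use e in auto)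
  also have "\<dots> \<le> (\<Sum>j\<in>{k..<m}. \<integral>x. (D j x)\<^sup>2 \<partial>M) / e\<^sup>2"
    unfolding S_def
    by (intro divide_right_mono second_moment_transform I_meas km) (auto simp: I_def)
  finally show ?thesis .
qed

text \<open>The tail of the variance series bounds the probability that the partial sums started at
  \<open>k\<close> ever reach size \<open>e\<close>. Letting \<open>k\<close> grow makes the partial
  sums Cauchy off a null set.\<close>

lemma AE_summable:
  assumes sm: "summable (\<lambda>n. \<integral>x. (D n x)\<^sup>2 \<partial>M)"
  shows "AE x in M. summable (\<lambda>n. D n x)"
proof -
  define v where "v n = (\<integral>x. (D n x)\<^sup>2 \<partial>M)" for n
  have v0: "v n \<ge> 0" for n by (simp add: v_def)
  define E where "E e k = {x \<in> space M. \<exists>n\<ge>k. \<bar>\<Sum>j\<in>{k..<n}. D j x\<bar> \<ge> e}" for e k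
  have [measurable]: "E e k \<in> events" for e k unfolding E_def by measurable
  have prob_E: "prob (E e k) \<le> (\<Sum>j. v (j + k)) / e\<^sup>2" if "e > 0" for e k
  proof -
    \<comment> \<open>The maximal inequality has a finite horizon \<open>m\<close>; continuity from
      below along \<open>F m\<close> removes it.\<close>
    define F where "F m = {x \<in> space M. \<exists>n\<in>{k..m}. \<bar>\<Sum>j\<in>{k..<n}. D j x\<bar> \<ge> e}" for m
    have "(\<lambda>m. prob (F m)) \<longlonglongrightarrow> prob (\<Union>m. F m)"
      by (rule finite_Lim_measure_incseq) (force simp: F_def incseq_def)+
    moreover have "(\<Union>m. F m) = E e k" by (fastforce simp: F_def E_def)
    ultimately have "(\<lambda>m. prob (F m)) \<longlonglongrightarrow> prob (E e k)" by simp
    moreover have "\<forall>\<^sub>F m in sequentially. prob (F m) \<le> (\<Sum>j. v (j + k)) / e\<^sup>2"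
      using eventually_ge_at_top[of k]
    proof eventually_elim
      case (elim m)
      have "prob (F m) \<le> (\<Sum>j\<in>{k..<m}. v j) / e\<^sup>2"
        unfolding F_def v_def by (rule maximal_inequality[OF that elim])
      also have "(\<Sum>j\<in>{k..<m}. v j) = (\<Sum>j<m - k. v (j + k))"
        using elim sum.shift_bounds_nat_ivl[of v 0 k "m - k"] by (simp add: atLeast0LessThan)
      also have "\<dots> \<le> (\<Sum>j. v (j + k))"
        using sm v0 by (intro sum_le_suminf summable_ignore_initial_segment) (auto simp: v_def)
      finally show ?case by (simp add: divide_right_mono)
    qed
    ultimately show ?thesis by (rule tendsto_upperbound) simp
  qed
  have null: "AE x in M. \<exists>k. x \<notin> E e k" if "e > 0" for e
  proof -
    have "prob (\<Inter>k. E e k) \<le> (\<Sum>j. v (j + k)) / e\<^sup>2" for k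
      by (rule order_trans[OF finite_measure_mono prob_E[OF that, of k]]) auto
    moreover have "(\<lambda>k. (\<Sum>j. v (j + k)) / e\<^sup>2) \<longlonglongrightarrow> 0 / e\<^sup>2"
      using sm that by (intro tendsto_intros suminf_exist_split2) (auto simp: v_def)
    ultimately have "prob (\<Inter>k. E e k) \<le> 0"
      by (intro LIMSEQ_le_const[of _ "0 / e\<^sup>2", simplified]) auto
    hence "prob (\<Inter>k. E e k) = 0" using measure_nonneg[of M "\<Inter>k. E e k"] by linarith
    hence "AE x in M. x \<notin> (\<Inter>k. E e k)" by (subst (asm) prob_eq_0) auto
    thus ?thesis by simp
  qed
  \<comment> \<open>Only the countably many levels \<open>1 / real (Suc i)\<close> are used, so one
    null set serves all of them.\<close>
  have "AE x in M. \<forall>i::nat. \<exists>k. x \<notin> E (1 / real (Suc i)) k"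
    using null by (subst AE_all_countable) simp
  thus ?thesis using AE_space
  proof eventually_elim
    case (elim x)
    show ?case
      unfolding summable_Cauchy
    proof (intro allI impI)
      fix e :: real assume "e > 0"
      \<comment> \<open>Half of \<open>e\<close>, because a block from \<open>m\<close> to
        \<open>n\<close> is the difference of two sums that start at \<open>k\<close>.\<close>
      then obtain i where i: "1 / real (Suc i) < e / 2"
        using nat_approx_posE[of "e / 2"] by auto
      obtain k where k: "x \<notin> E (1 / real (Suc i)) k" using elim by blast
      have small: "\<bar>\<Sum>j\<in>{k..<n}. D j x\<bar> < e / 2" if "n \<ge> k" for n
      proof -
        have "\<bar>\<Sum>j\<in>{k..<n}. D j x\<bar> < 1 / real (Suc i)"
          using k elim(2) that unfolding E_def by (simp only: mem_Collect_eq) (metis not_le)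
        thus ?thesis using i by linarith
      qed
      show "\<exists>N. \<forall>m\<ge>N. \<forall>n. norm (\<Sum>j\<in>{m..<n}. D j x) < e"
      proof (intro exI[of _ k] allI impI)
        fix m n assume m: "k \<le> m"
        show "norm (\<Sum>j\<in>{m..<n}. D j x) < e"
        proof (cases "m \<le> n")
          case True
          have "(\<Sum>j\<in>{k..<n}. D j x) = (\<Sum>j\<in>{k..<m}. D j x) + (\<Sum>j\<in>{m..<n}. D j x)"
            using m True by (simp add: sum.atLeastLessThan_concat)
          thus ?thesis using small[of m] small[of n] m True unfolding real_norm_def by linarith
        qed (use \<open>e > 0\<close> in auto)
      qed
    qed
  qed
qed

end

subsection \<open>Strong laws with random weights\<close>

context increasing_subalgebras
begin

text \<open>\<open>orth\<close> and \<open>var\<close> put into integrated form that, given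
  \<open>G n\<close>, \<open>\<xi> n\<close> has mean 0 and second moment at most
  \<open>c * w n\<close>. Divergence of the weights is a premise inside the almost sure statement
  because it may hold on only part of the space.\<close>

lemma AE_weighted_average_tendsto_0:
  fixes \<xi> w :: "nat \<Rightarrow> 'a \<Rightarrow> real"
  assumes \<xi>_meas: "\<And>n. \<xi> n \<in> borel_measurable (G (Suc n))"
    and w_meas: "\<And>n. w n \<in> borel_measurable (G n)"
    and w_bd: "\<And>n. AE x in M. 0 \<le> w n x \<and> w n x \<le> c"
    and \<xi>_bd: "\<And>n. AE x in M. \<bar>\<xi> n x\<bar> \<le> c"
    and orth: "\<And>n U. U \<in> borel_measurable (G n) \<Longrightarrow> integrable M U \<Longrightarrow> (\<integral>x. U x * \<xi> n x \<partial>M) = 0"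
    and var: "\<And>n U. U \<in> borel_measurable (G n) \<Longrightarrow> (AE x in M. 0 \<le> U x \<and> U x \<le> 1) \<Longrightarrow>
                (\<integral>x. U x * (\<xi> n x)\<^sup>2 \<partial>M) \<le> c * (\<integral>x. U x * w n x \<partial>M)"
  shows "AE x in M. filterlim (\<lambda>n. \<Sum>j<n. w j x) at_top sequentially \<longrightarrow>
           (\<lambda>n. (\<Sum>j<n. \<xi> j x) / (\<Sum>j<n. w j x)) \<longlonglongrightarrow> 0"
proof -
  \<comment> \<open>The sum includes \<open>w n\<close> itself, which is already
    \<open>G n\<close>-measurable: \<open>V n\<close> is thus predictable, and its size matches the
    denominator in the telescoping bound.\<close>
  define V where "V n x = 1 + (\<Sum>j<Suc n. w j x)" for n x
  have w_AE: "AE x in M. \<forall>n. 0 \<le> w n x \<and> w n x \<le> c"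
    using w_bd by (simp add: AE_all_countable)
  have V_ge: "AE x in M. \<forall>n. 1 \<le> V n x"
    using w_AE by eventually_elim (auto simp: V_def intro!: add_nonneg_nonneg sum_nonneg)
  have V_meas: "V n \<in> borel_measurable (G n)" for n
    unfolding V_def by (intro borel_measurable_add borel_measurable_const borel_measurable_sum)
      (auto intro: measurable_mono[OF _ w_meas])
  have inv_meas: "(\<lambda>x. 1 / V n x) \<in> borel_measurable (G n)" for n
    using V_meas by measurable
  have [measurable]: "V n \<in> borel_measurable M" "w n \<in> borel_measurable M" "\<xi> n \<in> borel_measurable M" for n
    using V_meas w_meas \<xi>_meas measurable_M by blast+
  have inv_bd: "AE x in M. \<bar>1 / V n x\<bar> \<le> 1" for n
    using V_ge by eventually_elim (metis abs_1 abs_divide abs_ge_self divide_le_eq_1 order_less_le_trans order_trans zero_less_one)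
  have c0: "c \<ge> 0"
  proof -
    have "AE x in M. 0 \<le> c" using \<xi>_bd[of 0] by eventually_elim linarith
    thus ?thesis by simp
  qed
  interpret mart: bounded_mart_diff M G "\<lambda>n x. \<xi> n x / V n x" c
  proof
    fix n
    show "(\<lambda>x. \<xi> n x / V n x) \<in> borel_measurable (G (Suc n))"
      using \<xi>_meas measurable_mono[OF _ V_meas, of n "Suc n"] by measurable
    show "AE x in M. \<bar>\<xi> n x / V n x\<bar> \<le> c"
      using V_ge \<xi>_bd[of n]
    proof eventually_elim
      case (elim x)
      have "\<bar>\<xi> n x\<bar> / V n x \<le> \<bar>\<xi> n x\<bar> / 1"
        using elim by (intro divide_left_mono) (auto intro: mult_pos_pos less_le_trans[of 0 1])
      moreover have "\<bar>V n x\<bar> = V n x" using elim(1)[rule_format, of n] by simp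
      ultimately show ?case using elim(2) by (simp add: abs_divide)
    qed
    fix U :: "'a \<Rightarrow> real" assume U: "U \<in> borel_measurable (G n)" "integrable M U"
    have [measurable]: "U \<in> borel_measurable M" using U(1) measurable_M by blast
    have "(\<integral>x. (U x * (1 / V n x)) * \<xi> n x \<partial>M) = 0"
    proof (rule orth)
      show "(\<lambda>x. U x * (1 / V n x)) \<in> borel_measurable (G n)" using U(1) inv_meas by measurable
      show "integrable M (\<lambda>x. U x * (1 / V n x))"
      proof (rule Bochner_Integration.integrable_bound[OF U(2)])
        show "AE x in M. norm (U x * (1 / V n x)) \<le> norm (U x)"
          using inv_bd[of n] by eventually_elim (simp only: real_norm_def abs_mult mult_left_le abs_ge_zero)
      qed measurable
    qed
    thus "(\<integral>x. U x * (\<xi> n x / V n x) \<partial>M) = 0" by simp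
  qed
  have int: "integrable M (\<lambda>x. w n x / (V n x)\<^sup>2)" for n
  proof (rule integrable_AE_bounded)
    show "AE x in M. \<bar>w n x / (V n x)\<^sup>2\<bar> \<le> c"
      using w_AE V_ge
    proof eventually_elim
      case (elim x)
      have "1 \<le> (V n x)\<^sup>2" using elim(2) by (simp add: one_le_power)
      hence "w n x / (V n x)\<^sup>2 \<le> w n x / 1" using elim(1) elim(2)[rule_format, of n]
        by (intro divide_left_mono) simp_all
      thus ?case using elim(1)[rule_format, of n] by simp
    qed
  qed measurable
  \<comment> \<open>The test function \<open>(1 / V j x)\<^sup>2\<close> in \<open>var\<close> turns
    each second moment into \<open>c\<close> times the mean of
    \<open>w j x / (V j x)\<^sup>2\<close>; by telescoping these add up to at most
    \<open>c\<close>.\<close>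
  have "summable (\<lambda>n. \<integral>x. (\<xi> n x / V n x)\<^sup>2 \<partial>M)"
  proof (rule summableI_nonneg_bounded)
    fix n
    show "0 \<le> (\<integral>x. (\<xi> n x / V n x)\<^sup>2 \<partial>M)" by simp
    have step: "(\<integral>x. (\<xi> j x / V j x)\<^sup>2 \<partial>M) \<le> c * (\<integral>x. w j x / (V j x)\<^sup>2 \<partial>M)" for j
    proof -
      have "(\<integral>x. (1 / V j x)\<^sup>2 * (\<xi> j x)\<^sup>2 \<partial>M) \<le> c * (\<integral>x. (1 / V j x)\<^sup>2 * w j x \<partial>M)"
      proof (rule var)
        show "(\<lambda>x. (1 / V j x)\<^sup>2) \<in> borel_measurable (G j)" using inv_meas by measurable
        show "AE x in M. 0 \<le> (1 / V j x)\<^sup>2 \<and> (1 / V j x)\<^sup>2 \<le> 1"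
          using inv_bd[of j] by eventually_elim (simp only: zero_le_power2 abs_square_le_1)
      qed
      thus ?thesis by (simp add: power_divide)
    qed
    have "(\<Sum>j<n. \<integral>x. (\<xi> j x / V j x)\<^sup>2 \<partial>M) \<le> (\<Sum>j<n. c * (\<integral>x. w j x / (V j x)\<^sup>2 \<partial>M))"
      by (intro sum_mono step)
    also have "\<dots> = c * (\<integral>x. (\<Sum>j<n. w j x / (V j x)\<^sup>2) \<partial>M)"
      using int by (simp add: sum_distrib_left)
    also have "(\<integral>x. (\<Sum>j<n. w j x / (V j x)\<^sup>2) \<partial>M) \<le> (\<integral>x. 1 \<partial>M)"
    proof (rule integral_mono_AE)
      show "AE x in M. (\<Sum>j<n. w j x / (V j x)\<^sup>2) \<le> 1"
        using w_AE
      proof eventually_elim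
        case (elim x)
        have "0 \<le> 1 / (1 + (\<Sum>i<n. w i x))"
          using elim by (intro divide_nonneg_nonneg add_nonneg_nonneg sum_nonneg) auto
        moreover have "(\<Sum>j<n. w j x / (V j x)\<^sup>2) \<le> 1 - 1 / (1 + (\<Sum>i<n. w i x))"
          unfolding V_def using elim by (intro sum_weight_over_square_le_one) auto
        ultimately show ?case by linarith
      qed
    qed (use int in auto)
    finally show "(\<Sum>j<n. \<integral>x. (\<xi> j x / V j x)\<^sup>2 \<partial>M) \<le> c"
      using c0 by (simp add: mult_left_mono prob_space)
  qed
  from mart.AE_summable[OF this] w_AE show ?thesis
    by eventually_elim (auto simp: V_def intro!: kronecker_weighted)
qed

text \<open>For values in [0, c] the square of \<open>Y - w\<close> is at most
  \<open>c * (Y + w)\<close>, and the conditional mean of this bound is \<open>2 * c * w\<close>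
  because \<open>w\<close> compensates \<open>Y\<close>. So the variance is controlled by the weight
  \<open>w\<close> itself, as the weighted strong law demands.\<close>

lemma AE_ratio_to_compensator:
  fixes Y w :: "nat \<Rightarrow> 'a \<Rightarrow> real"
  assumes Y_meas: "\<And>n. Y n \<in> borel_measurable (G (Suc n))"
    and w_meas: "\<And>n. w n \<in> borel_measurable (G n)"
    and Y_bd: "\<And>n. AE x in M. 0 \<le> Y n x \<and> Y n x \<le> c"
    and w_bd: "\<And>n. AE x in M. 0 \<le> w n x \<and> w n x \<le> c"
    and comp: "\<And>n U. U \<in> borel_measurable (G n) \<Longrightarrow> integrable M U \<Longrightarrow>
                 (\<integral>x. U x * Y n x \<partial>M) = (\<integral>x. U x * w n x \<partial>M)"
  shows "AE x in M. filterlim (\<lambda>n. \<Sum>j<n. w j x) at_top sequentially \<longrightarrow>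
           (\<lambda>n. (\<Sum>j<n. Y j x) / (\<Sum>j<n. w j x)) \<longlonglongrightarrow> 1"
proof -
  have [measurable]: "w n \<in> borel_measurable M" "Y n \<in> borel_measurable M" for n
    using w_meas Y_meas measurable_M by blast+
  have c0: "c \<ge> 0"
  proof -
    have "AE x in M. 0 \<le> c" using Y_bd[of 0] by eventually_elim linarith
    thus ?thesis by simp
  qed
  have prod_int: "integrable M (\<lambda>x. U x * f x)"
    if "integrable M U" "f \<in> borel_measurable M" "AE x in M. 0 \<le> f x \<and> f x \<le> c" for U f :: "'a \<Rightarrow> real"
  proof (rule Bochner_Integration.integrable_bound)
    show "integrable M (\<lambda>x. c * U x)" using that by simp
    show "(\<lambda>x. U x * f x) \<in> borel_measurable M" using that by measurable
    show "AE x in M. norm (U x * f x) \<le> norm (c * U x)"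
      using that(3) by eventually_elim
        (use c0 in \<open>auto simp: abs_mult mult.commute[of c] intro!: mult_left_mono\<close>)
  qed
  have "AE x in M. filterlim (\<lambda>n. \<Sum>j<n. w j x) at_top sequentially \<longrightarrow>
           (\<lambda>n. (\<Sum>j<n. Y j x - w j x) / (\<Sum>j<n. w j x)) \<longlonglongrightarrow> 0"
  \<comment> \<open>One constant has to serve three bounds: \<open>c\<close> for the weights and the
    increments, \<open>2 * c\<close> for the variance.\<close>
  proof (rule AE_weighted_average_tendsto_0[where c = "max c (2 * c)"])
    fix n
    show "(\<lambda>x. Y n x - w n x) \<in> borel_measurable (G (Suc n))"
      using Y_meas measurable_mono[OF _ w_meas, of n "Suc n"] by measurable
    show "AE x in M. 0 \<le> w n x \<and> w n x \<le> max c (2 * c)"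
      using w_bd[of n] by eventually_elim auto
    show "AE x in M. \<bar>Y n x - w n x\<bar> \<le> max c (2 * c)"
      using w_bd[of n] Y_bd[of n] by eventually_elim auto
    fix U :: "'a \<Rightarrow> real" assume U: "U \<in> borel_measurable (G n)"
    { assume "integrable M U"
      with comp[OF U] prod_int Y_bd w_bd show "(\<integral>x. U x * (Y n x - w n x) \<partial>M) = 0"
        by (simp add: algebra_simps) }
    { assume U01: "AE x in M. 0 \<le> U x \<and> U x \<le> 1"
      have Um[measurable]: "U \<in> borel_measurable M" using U measurable_M by blast
      have Ui: "integrable M U"
        using U01 by (intro integrable_AE_bounded[of _ 1]) (auto elim: eventually_mono)
      have iY: "integrable M (\<lambda>x. U x * Y n x)" and iw: "integrable M (\<lambda>x. U x * w n x)"
        using prod_int[OF Ui] Y_bd w_bd by auto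
      have "(\<integral>x. U x * (Y n x - w n x)\<^sup>2 \<partial>M) \<le> (\<integral>x. c * (U x * Y n x + U x * w n x) \<partial>M)"
      proof (rule integral_mono_AE)
        have *: "AE x in M. 0 \<le> U x * (Y n x - w n x)\<^sup>2 \<and>
            U x * (Y n x - w n x)\<^sup>2 \<le> c * (U x * Y n x + U x * w n x)"
          using U01 Y_bd[of n] w_bd[of n]
        proof eventually_elim
          case (elim x)
          have "(Y n x - w n x)\<^sup>2 = \<bar>Y n x - w n x\<bar> * \<bar>Y n x - w n x\<bar>" by (simp add: power2_eq_square)
          also have "\<dots> \<le> c * (Y n x + w n x)" using elim by (intro mult_mono) auto
          finally have "U x * (Y n x - w n x)\<^sup>2 \<le> U x * (c * (Y n x + w n x))"
            using elim by (intro mult_left_mono) auto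
          thus ?case using elim by (simp add: algebra_simps)
        qed
        thus "AE x in M. U x * (Y n x - w n x)\<^sup>2 \<le> c * (U x * Y n x + U x * w n x)"
          by eventually_elim simp
        show i: "integrable M (\<lambda>x. c * (U x * Y n x + U x * w n x))"
          using iY iw by simp
        show "integrable M (\<lambda>x. U x * (Y n x - w n x)\<^sup>2)"
          using * by (intro Bochner_Integration.integrable_bound[OF i]) (auto elim: eventually_mono)
      qed
      also have "\<dots> = 2 * c * (\<integral>x. U x * w n x \<partial>M)"
        using iY iw comp[OF U Ui] by simp
      also have "\<dots> \<le> max c (2 * c) * (\<integral>x. U x * w n x \<partial>M)"
        using c0 by simp
      finally show "(\<integral>x. U x * (Y n x - w n x)\<^sup>2 \<partial>M) \<le> max c (2 * c) * (\<integral>x. U x * w n x \<partial>M)" . }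
  qed (rule w_meas)
  thus ?thesis
  proof eventually_elim
    case (elim x)
    show ?case
    proof
      assume div: "filterlim (\<lambda>n. \<Sum>j<n. w j x) at_top sequentially"
      have "(\<lambda>n. (\<Sum>j<n. Y j x - w j x) / (\<Sum>j<n. w j x) + 1) \<longlonglongrightarrow> 0 + 1"
        using elim div by (intro tendsto_intros) auto
      moreover have "\<forall>\<^sub>F n in sequentially. (\<Sum>j<n. w j x) > 0"
        using div by (simp add: filterlim_at_top_dense)
      hence "\<forall>\<^sub>F n in sequentially. (\<Sum>j<n. Y j x - w j x) / (\<Sum>j<n. w j x) + 1
          = (\<Sum>j<n. Y j x) / (\<Sum>j<n. w j x)"
        by eventually_elim (simp add: sum_subtractf field_simps)
      ultimately show "(\<lambda>n. (\<Sum>j<n. Y j x) / (\<Sum>j<n. w j x)) \<longlonglongrightarrow> 1"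
        using Lim_transform_eventually by fastforce
    qed
  qed
qed

end

subsection \<open>Moments of the hypergeometric distribution\<close>

text \<open>Absorption, \<open>k * (h choose k) = h * ((h - 1) choose (k - 1))\<close>, followed by
  Vandermonde's identity.\<close>

lemma hypergeometric_mean:
  assumes "n \<le> s" "h \<le> s" "1 \<le> s"
  shows "(\<Sum>k\<le>n. real k * pmf (hypergeometric_pmf n s h) k) = real n * real h / real s"
proof (cases "n = 0 \<or> h = 0")
  case True
  have "real k * pmf (hypergeometric_pmf n s h) k = 0" if "k \<le> n" for k
    using True that assms by (cases k) (auto simp: pmf_hypergeometric)
  hence "(\<Sum>k\<le>n. real k * pmf (hypergeometric_pmf n s h) k) = 0" by (intro sum.neutral) auto
  thus ?thesis using True by auto
next
  case False
  then obtain n' h' where n: "n = Suc n'" and h: "h = Suc h'" by (meson not0_implies_Suc)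
  obtain s' where s: "s = Suc s'" using assms by (metis Suc_le_D One_nat_def)
  have "(\<Sum>k\<le>n. k * ((h choose k) * ((s - h) choose (n - k))))
      = (\<Sum>k\<le>n'. Suc k * ((h choose Suc k) * ((s - h) choose (n - Suc k))))"
    unfolding n by (subst sum.atMost_Suc_shift) simp
  also have "\<dots> = (\<Sum>k\<le>n'. h * ((h' choose k) * ((s - h) choose (n' - k))))"
  proof (intro sum.cong refl)
    fix k
    have "Suc k * (h choose Suc k) = h * (h' choose k)"
      unfolding h by (simp only: Suc_times_binomial_eq mult_ac)
    thus "Suc k * ((h choose Suc k) * ((s - h) choose (n - Suc k)))
        = h * ((h' choose k) * ((s - h) choose (n' - k)))"
      unfolding n diff_Suc_Suc by (simp only: mult.assoc[symmetric])
  qed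
  also have "\<dots> = h * ((h' + (s - h)) choose n')"
    unfolding sum_distrib_left[symmetric] vandermonde ..
  also have "h' + (s - h) = s'" using assms h s by simp
  finally have 1: "(\<Sum>k\<le>n. k * ((h choose k) * ((s - h) choose (n - k)))) = h * (s' choose n')" .
  have "(\<Sum>k\<le>n. real k * pmf (hypergeometric_pmf n s h) k)
      = real (\<Sum>k\<le>n. k * ((h choose k) * ((s - h) choose (n - k)))) / real (s choose n)"
    using assms unfolding of_nat_sum sum_divide_distrib
    by (intro sum.cong refl) (simp add: pmf_hypergeometric)
  also have "\<dots> = real h * real (s' choose n') / real (s choose n)" by (simp add: 1)
  also have "\<dots> = real n * real h / real s"
  proof -
    have "real s * real (s' choose n') = real (s choose n) * real n"
      unfolding s n of_nat_mult[symmetric] by (simp only: Suc_times_binomial_eq)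
    moreover have "real (s choose n) \<noteq> 0" "real s \<noteq> 0" using assms by auto
    ultimately show ?thesis by (simp add: field_simps)
  qed
  finally show ?thesis .
qed

lemma hypergeometric_total:
  assumes "n \<le> s" "h \<le> s"
  shows "(\<Sum>k\<le>n. pmf (hypergeometric_pmf n s h) k) = 1"
proof -
  have "(\<Sum>k\<le>n. pmf (hypergeometric_pmf n s h) k)
      = real (\<Sum>k\<le>n. (h choose k) * ((s - h) choose (n - k))) / real (s choose n)"
    using assms unfolding of_nat_sum sum_divide_distrib
    by (intro sum.cong refl) (simp add: pmf_hypergeometric)
  also have "\<dots> = 1" unfolding vandermonde using assms by simp
  finally show ?thesis .
qed

lemma hypergeometric_mean_complement:
  assumes "n \<le> s" "h \<le> s" "1 \<le> s"
  shows "(\<Sum>k\<le>n. (real n - real k) * pmf (hypergeometric_pmf n s h) k) = real n * (real s - real h) / real s"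
proof -
  have "(\<Sum>k\<le>n. (real n - real k) * pmf (hypergeometric_pmf n s h) k)
      = real n * (\<Sum>k\<le>n. pmf (hypergeometric_pmf n s h) k) - (\<Sum>k\<le>n. real k * pmf (hypergeometric_pmf n s h) k)"
    by (simp add: sum_subtractf sum_distrib_left left_diff_distrib)
  thus ?thesis using assms by (simp add: hypergeometric_total hypergeometric_mean field_simps)
qed

text \<open>The factor \<open>k\<close> is absorbed into the binomial of one colour and
  \<open>n - k\<close> into that of the other; Vandermonde's identity then sums what
  remains.\<close>

lemma hypergeometric_mean_product:
  assumes "n \<le> s" "h \<le> s" "2 \<le> s"
  shows "(\<Sum>k\<le>n. real k * (real n - real k) * pmf (hypergeometric_pmf n s h) k)
    = real n * (real n - 1) * (real h * (real s - real h)) / (real s * (real s - 1))"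
\<comment> \<open>In these cases at most one ball is drawn or one colour is missing, so both sides
  vanish; otherwise \<open>n\<close>, \<open>s\<close>, \<open>h\<close> and \<open>s - h\<close>
  have the predecessors that absorption uses.\<close>
proof (cases "n \<le> 1 \<or> h = 0 \<or> h = s")
  case True
  have "real k * (real n - real k) * pmf (hypergeometric_pmf n s h) k = 0" if "k \<le> n" for k
  proof (cases "k = 0 \<or> k = n")
    case False
    thus ?thesis using True that assms by (auto simp: pmf_hypergeometric)
  qed auto
  hence "(\<Sum>k\<le>n. real k * (real n - real k) * pmf (hypergeometric_pmf n s h) k) = 0"
    by (intro sum.neutral) auto
  moreover have "n = 0 \<or> n = 1 \<or> h = 0 \<or> h = s" using True by auto
  ultimately show ?thesis by auto
next
  case False
  have "\<exists>n'. n = 2 + n'" "\<exists>s'. s = 2 + s'" using False assms by (intro le_Suc_ex; simp)+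
  then obtain n' s' where n: "n = Suc (Suc n')" and s: "s = Suc (Suc s')" by auto
  obtain h' where h: "h = Suc h'" using False by (meson not0_implies_Suc)
  obtain g where g: "s - h = Suc g" using False assms by (metis diff_is_0_eq le_antisym not0_implies_Suc)
  have sh: "h' + g = s'" using g h s assms by linarith
  have "(\<Sum>k\<le>n. k * (n - k) * ((h choose k) * ((s - h) choose (n - k))))
      = (\<Sum>k\<le>Suc n'. Suc k * (n - Suc k) * ((h choose Suc k) * ((s - h) choose (n - Suc k))))"
    unfolding n by (subst sum.atMost_Suc_shift) simp
  \<comment> \<open>The last term \<open>k = Suc n'\<close> drops out because
    \<open>n - Suc k\<close> is 0 there.\<close>
  also have "\<dots> = (\<Sum>k\<le>n'. Suc k * (n - Suc k) * ((h choose Suc k) * ((s - h) choose (n - Suc k))))"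
    unfolding n by simp
  also have "\<dots> = (\<Sum>k\<le>n'. h * (s - h) * ((h' choose k) * (g choose (n' - k))))"
  proof (intro sum.cong refl)
    fix k assume k: "k \<in> {..n'}"
    hence nk: "n - Suc k = Suc (n' - k)" unfolding n by auto
    have "Suc k * (h choose Suc k) = h * (h' choose k)"
      unfolding h by (simp only: Suc_times_binomial_eq mult_ac)
    moreover have "(n - Suc k) * ((s - h) choose (n - Suc k)) = (s - h) * (g choose (n' - k))"
      unfolding g nk by (simp only: Suc_times_binomial_eq mult_ac)
    ultimately have "(Suc k * (h choose Suc k)) * ((n - Suc k) * ((s - h) choose (n - Suc k)))
       = (h * (h' choose k)) * ((s - h) * (g choose (n' - k)))" by (simp only:)
    thus "Suc k * (n - Suc k) * ((h choose Suc k) * ((s - h) choose (n - Suc k)))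
       = h * (s - h) * ((h' choose k) * (g choose (n' - k)))" by (simp only: mult_ac)
  qed
  also have "\<dots> = h * (s - h) * (s' choose n')"
    unfolding sum_distrib_left[symmetric] vandermonde sh ..
  finally have 1: "(\<Sum>k\<le>n. k * (n - k) * ((h choose k) * ((s - h) choose (n - k))))
     = h * (s - h) * (s' choose n')" .
  have "(\<Sum>k\<le>n. real k * (real n - real k) * pmf (hypergeometric_pmf n s h) k)
      = real (\<Sum>k\<le>n. k * (n - k) * ((h choose k) * ((s - h) choose (n - k)))) / real (s choose n)"
    using assms unfolding of_nat_sum sum_divide_distrib
    by (intro sum.cong refl) (simp add: pmf_hypergeometric of_nat_diff)
  also have "\<dots> = real h * (real s - real h) * real (s' choose n') / real (s choose n)"
    unfolding 1 using assms by (simp add: of_nat_diff)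
  also have "\<dots> = real n * (real n - 1) * (real h * (real s - real h)) / (real s * (real s - 1))"
  proof -
    have "real s * real (Suc s' choose Suc n') = real (s choose n) * real n"
      unfolding s n of_nat_mult[symmetric] by (simp only: Suc_times_binomial_eq)
    moreover have "(real s - 1) * real (s' choose n') = real (Suc s' choose Suc n') * (real n - 1)"
    proof -
      have "real s - 1 = real (Suc s')" "real n - 1 = real (Suc n')" by (simp_all add: s n)
      thus ?thesis unfolding of_nat_mult[symmetric] by (simp only: of_nat_mult[symmetric] Suc_times_binomial_eq)
    qed
    ultimately have "real s * (real s - 1) * real (s' choose n') = real n * (real n - 1) * real (s choose n)"
      by algebra
    moreover have "real (s choose n) \<noteq> 0" "real s * (real s - 1) \<noteq> 0" using assms by auto
    ultimately show ?thesis by (simp add: frac_eq_eq mult_ac)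
  qed
  finally show ?thesis .
qed

subsection \<open>The urn filtrations\<close>

lemma space_gen_sigma [simp]: "space (gen_sigma M \<Y>) = space M"
  by (simp add: gen_sigma_def space_measure_of_conv)

lemma sets_gen_sigma:
  "sets (gen_sigma M \<Y>) = sigma_sets (space M) {Y -` S \<inter> space M | Y S. Y \<in> \<Y>}"
  unfolding gen_sigma_def by (rule sets_measure_of) auto

lemma measurable_gen_sigma: "Y \<in> \<Y> \<Longrightarrow> Y \<in> measurable (gen_sigma M \<Y>) (count_space UNIV)"
  by (rule measurableI) (auto simp: sets_gen_sigma intro!: sigma_sets.Basic)

lemma gen_sigma_mono: "\<Y> \<subseteq> \<Z> \<Longrightarrow> sets (gen_sigma M \<Y>) \<subseteq> sets (gen_sigma M \<Z>)"
  unfolding sets_gen_sigma by (rule sigma_sets_mono') auto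

lemma subalgebra_gen_sigma:
  assumes "\<And>Y. Y \<in> \<Y> \<Longrightarrow> Y \<in> measurable M (count_space UNIV)"
  shows "subalgebra M (gen_sigma M \<Y>)"
  unfolding subalgebra_def sets_gen_sigma
  using assms by (auto intro!: sets.sigma_sets_subset dest: measurable_sets)

text \<open>Countability of the naturals makes any function of two measurable counts measurable;
  this covers expressions such as hypergeometric probabilities with random parameters.\<close>

lemma measurable_of_nat_fun2:
  fixes f :: "nat \<Rightarrow> nat \<Rightarrow> 'b"
  assumes "g \<in> measurable M (count_space UNIV)" "h \<in> measurable M (count_space UNIV)"
    and "\<And>i j. f i j \<in> space S"
  shows "(\<lambda>x. f (g x) (h x)) \<in> measurable M S"
  by (rule measurable_compose_countable[OF measurable_compose_countable[OF _ assms(2)] assms(1)])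
     (use assms(3) in simp)

text \<open>Otherwise Kronecker's lemma would force the averages of \<open>x\<close> to tend to 0.\<close>

lemma sums_at_top_of_average:
  fixes x y :: "nat \<Rightarrow> real"
  assumes x: "\<And>n. 0 \<le> x n" and avg: "(\<lambda>n. (\<Sum>j<n. x j) / real n) \<longlonglongrightarrow> l" and l: "l > 0"
    and \<delta>: "\<delta> > 0" and y: "\<And>n. \<delta> * x n / (real n + 2) \<le> y n"
  shows "filterlim (\<lambda>n. \<Sum>j<n. y j) at_top sequentially"
proof (rule ccontr)
  assume "\<not> ?thesis"
  then obtain Z where Z: "\<And>m. \<exists>n\<ge>m. (\<Sum>j<n. y j) < Z"
    by (auto simp: filterlim_at_top eventually_sequentially not_le)
  have y0: "y n \<ge> 0" for n
    using x[of n] \<delta> by (intro order_trans[OF _ y[of n]]) auto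
  have "summable y"
  proof (rule summableI_nonneg_bounded[of _ Z])
    fix m
    obtain n where n: "n \<ge> m" "(\<Sum>j<n. y j) < Z" using Z by blast
    have "(\<Sum>j<m. y j) \<le> (\<Sum>j<n. y j)" using n y0 by (intro sum_mono2) auto
    thus "(\<Sum>j<m. y j) \<le> Z" using n by simp
  qed (rule y0)
  hence "summable (\<lambda>n. \<delta> * x n / (real n + 2))"
    by (rule summable_comparison_test') (use y x \<delta> in auto)
  hence "summable (\<lambda>n. (1 / \<delta>) * (\<delta> * x n / (real n + 2)))" by (rule summable_mult)
  \<comment> \<open>With constant weights 1 the normaliser of \<open>kronecker_weighted\<close> is
    \<open>n + 2\<close>, which is where that denominator in the hypothesis on \<open>y\<close>
    comes from.\<close>
  hence "summable (\<lambda>n. x n / (1 + (\<Sum>j<Suc n. 1)))" using \<delta> by (simp add: add.commute)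
  hence "(\<lambda>n. (\<Sum>j<n. x j) / (\<Sum>j<n. 1)) \<longlonglongrightarrow> 0"
    by (intro kronecker_weighted) (auto simp: filterlim_real_sequentially)
  with avg have "l = 0" by (intro LIMSEQ_unique[OF avg]) simp
  thus False using l by simp
qed

context urn_model
begin

text \<open>Interleaved information,
  \<open>F n \<subseteq> FN n \<subseteq> FX n \<subseteq> F (Suc n)\<close>: before step
  \<open>n + 1\<close>, once its draw size is known, and once its colours are known as well. Each
  kind of variable is centred given the stage just before it is revealed.\<close>

abbreviation "F \<equiv> urn_F M N X A B"
abbreviation "FN \<equiv> \<lambda>n. gen_sigma M (urn_vars N X A B n \<union> {N (Suc n)})"
abbreviation "FX \<equiv> \<lambda>n. gen_sigma M (urn_vars N X A B n \<union> {N (Suc n), X (Suc n)})"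
abbreviation "H \<equiv> urn_H a X A"
abbreviation "K \<equiv> urn_K b N X B"
abbreviation "S \<equiv> \<lambda>n \<omega>. H n \<omega> + K n \<omega>"

lemma urn_vars_Suc:
  "urn_vars N X A B (Suc n) = urn_vars N X A B n \<union> {N (Suc n), X (Suc n), A (Suc n), B (Suc n)}"
  by (auto simp: urn_vars_def atLeastAtMostSuc_conv)

lemma urn_vars_meas: "Y \<in> urn_vars N X A B n \<Longrightarrow> Y \<in> measurable M (count_space UNIV)"
  using rv by (auto simp: urn_vars_def)

sublocale F: increasing_subalgebras M F
proof
  fix n
  show "subalgebra M (F n)"
    unfolding urn_F_def by (rule subalgebra_gen_sigma) (rule urn_vars_meas)
  show "sets (F n) \<subseteq> sets (F (Suc n))"
    unfolding urn_F_def by (rule gen_sigma_mono) (auto simp: urn_vars_Suc)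
qed

sublocale FN: increasing_subalgebras M FN
proof
  fix n
  show "subalgebra M (FN n)"
    by (rule subalgebra_gen_sigma) (use urn_vars_meas rv(1)[of "Suc n"] in auto)
  show "sets (FN n) \<subseteq> sets (FN (Suc n))"
    by (rule gen_sigma_mono) (auto simp: urn_vars_Suc)
qed

sublocale FX: increasing_subalgebras M FX
proof
  fix n
  show "subalgebra M (FX n)"
    by (rule subalgebra_gen_sigma) (use urn_vars_meas rv(1,2)[of "Suc n"] in auto)
  show "sets (FX n) \<subseteq> sets (FX (Suc n))"
    by (rule gen_sigma_mono) (auto simp: urn_vars_Suc)
qed

lemma measurable_FN_FX: "f \<in> measurable (FN n) L \<Longrightarrow> f \<in> measurable (FX n) L"
  using gen_sigma_mono[of "urn_vars N X A B n \<union> {N (Suc n)}" "urn_vars N X A B n \<union> {N (Suc n), X (Suc n)}" M]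
  by (auto simp: measurable_def)

lemma measurable_F_FN: "f \<in> measurable (F n) L \<Longrightarrow> f \<in> measurable (FN n) L"
  using gen_sigma_mono[of "urn_vars N X A B n" "urn_vars N X A B n \<union> {N (Suc n)}" M]
  by (auto simp: measurable_def urn_F_def)

lemma measurable_FX_F: "f \<in> measurable (FX n) L \<Longrightarrow> f \<in> measurable (F (Suc n)) L"
  using gen_sigma_mono[of "urn_vars N X A B n \<union> {N (Suc n), X (Suc n)}" "urn_vars N X A B (Suc n)" M]
  by (auto simp: measurable_def urn_F_def urn_vars_Suc)

lemma measurable_vars_F:
  assumes "1 \<le> j" "j \<le> n"
  shows "N j \<in> measurable (F n) (count_space UNIV)" "X j \<in> measurable (F n) (count_space UNIV)"
    "A j \<in> measurable (F n) (count_space UNIV)" "B j \<in> measurable (F n) (count_space UNIV)"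
  using assms by (auto simp: urn_F_def urn_vars_def intro!: measurable_gen_sigma)

lemma measurable_H: "H n \<in> measurable (F n) (count_space UNIV)"
proof -
  have "(\<lambda>\<omega>. \<Sum>j=1..n. A j \<omega> * X j \<omega>) \<in> measurable (F n) (count_space UNIV)"
    by (intro measurable_sum_nat measurable_of_nat_fun2[where f = "(*)"] measurable_vars_F) auto
  thus ?thesis unfolding urn_H_def by measurable
qed

lemma measurable_K: "K n \<in> measurable (F n) (count_space UNIV)"
proof -
  have "(\<lambda>\<omega>. \<Sum>j=1..n. B j \<omega> * (N j \<omega> - X j \<omega>)) \<in> measurable (F n) (count_space UNIV)"
    by (intro measurable_sum_nat measurable_of_nat_fun2[where f = "(*)"]
          measurable_of_nat_fun2[where f = "(-)"] measurable_vars_F) auto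
  thus ?thesis unfolding urn_K_def by measurable
qed

lemma measurable_S: "S n \<in> measurable (F n) (count_space UNIV)"
  by (rule measurable_of_nat_fun2[OF measurable_H measurable_K]) simp

lemma measurable_N_FN: "N (Suc n) \<in> measurable (FN n) (count_space UNIV)"
  by (rule measurable_gen_sigma) simp

lemma measurable_X_FX: "X (Suc n) \<in> measurable (FX n) (count_space UNIV)"
  by (rule measurable_gen_sigma) simp

lemma measurable_FN_fun3:
  fixes f :: "nat \<Rightarrow> nat \<Rightarrow> nat \<Rightarrow> real"
  shows "(\<lambda>\<omega>. f (N (Suc n) \<omega>) (S n \<omega>) (H n \<omega>)) \<in> borel_measurable (FN n)"
  by (rule measurable_compose_countable[OF measurable_of_nat_fun2
        [OF measurable_F_FN[OF measurable_S] measurable_F_FN[OF measurable_H]] measurable_N_FN]) simp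

lemma measurable_FX_fun2:
  fixes f :: "nat \<Rightarrow> nat \<Rightarrow> real"
  shows "(\<lambda>\<omega>. f (N (Suc n) \<omega>) (X (Suc n) \<omega>)) \<in> borel_measurable (FX n)"
  by (rule measurable_of_nat_fun2[OF measurable_FN_FX[OF measurable_N_FN] measurable_X_FX]) simp

section \<open>Almost sure bounds on the draws\<close>

definition "C = (SOME C. \<forall>n\<ge>1. AE \<omega> in M. A n \<omega> \<le> C \<and> B n \<omega> \<le> C \<and> N n \<omega> \<le> C)"

lemma AE_le_C: "AE \<omega> in M. \<forall>n\<ge>1. A n \<omega> \<le> C \<and> B n \<omega> \<le> C \<and> N n \<omega> \<le> C"
proof -
  have "\<forall>n\<ge>1. AE \<omega> in M. A n \<omega> \<le> C \<and> B n \<omega> \<le> C \<and> N n \<omega> \<le> C"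
    unfolding C_def by (rule someI_ex[OF bounded])
  thus ?thesis by (auto simp: AE_all_countable)
qed

text \<open>Integrating the conditional probability over the whole space gives the event probability
  1.\<close>

lemma AE_N_range: "AE \<omega> in M. \<forall>n. 1 \<le> N (Suc n) \<omega> \<and> N (Suc n) \<omega> \<le> S n \<omega>"
  unfolding AE_all_countable
proof
  fix n
  interpret sub: finite_measure_subalgebra M "F n" by unfold_locales (rule F.subalg)
  define E where "E = {\<omega> \<in> space M. N (Suc n) \<omega> \<in> {1..S n \<omega>}}"
  have [measurable]: "N (Suc n) \<in> measurable M (count_space UNIV)" "S n \<in> measurable M (count_space UNIV)"
    using rv F.measurable_M[OF measurable_S] by auto
  have "Measurable.pred M (\<lambda>\<omega>. 1 \<le> N (Suc n) \<omega> \<and> N (Suc n) \<omega> \<le> S n \<omega>)"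
    by (rule measurable_of_nat_fun2[where f = "\<lambda>i j. 1 \<le> i \<and> i \<le> j"]) auto
  hence E[measurable]: "E \<in> events" unfolding E_def by (simp add: pred_def)
  have "prob E = (\<integral>\<omega>. indicator E \<omega> \<partial>M)" by simp
  also have "\<dots> = (\<integral>\<omega>. real_cond_exp M (F n) (indicator E) \<omega> \<partial>M)"
    by (rule sub.real_cond_exp_int(2)[symmetric]) (simp add: integrable_real_indicator less_top[symmetric])
  also have "\<dots> = (\<integral>\<omega>. 1 \<partial>M)"
    using N_concentrated[of n] by (intro integral_cong_AE) (auto simp: E_def)
  finally have "prob E = 1" by (simp add: prob_space)
  hence "AE \<omega> in M. \<omega> \<in> E" by (simp add: AE_in_set_eq_1)
  thus "AE \<omega> in M. 1 \<le> N (Suc n) \<omega> \<and> N (Suc n) \<omega> \<le> S n \<omega>"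
    by eventually_elim (simp add: E_def)
qed

section \<open>Conditional moments of the draw\<close>

lemma integral_X_indicator:
  assumes U: "U \<in> borel_measurable (FN n)" "integrable M U"
  shows "(\<integral>\<omega>. U \<omega> * indicator {\<omega> \<in> space M. X (Suc n) \<omega> = k} \<omega> \<partial>M)
    = (\<integral>\<omega>. U \<omega> * pmf (hypergeometric_pmf (N (Suc n) \<omega>) (S n \<omega>) (H n \<omega>)) k \<partial>M)"
proof -
  interpret sub: finite_measure_subalgebra M "FN n" by unfold_locales (rule FN.subalg)
  let ?I = "indicator {\<omega> \<in> space M. X (Suc n) \<omega> = k} :: 'w \<Rightarrow> real"
  have Im[measurable]: "?I \<in> borel_measurable M" using rv(2)[of "Suc n"] by measurable
  have [measurable]: "U \<in> borel_measurable M" using U by measurable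
  have [measurable]: "(\<lambda>\<omega>. pmf (hypergeometric_pmf (N (Suc n) \<omega>) (S n \<omega>) (H n \<omega>)) k) \<in> borel_measurable M"
    using FN.measurable_M[OF measurable_FN_fun3[where f = "\<lambda>i j l. pmf (hypergeometric_pmf i j l) k"]] .
  have "integrable M (\<lambda>\<omega>. U \<omega> * ?I \<omega>)"
    by (rule Bochner_Integration.integrable_bound[OF U(2)]) (auto split: split_indicator)
  hence "(\<integral>\<omega>. U \<omega> * ?I \<omega> \<partial>M) = (\<integral>\<omega>. U \<omega> * real_cond_exp M (FN n) ?I \<omega> \<partial>M)"
    using sub.real_cond_exp_intg(2)[of U ?I] U(1) Im by simp
  also have "\<dots> = (\<integral>\<omega>. U \<omega> * pmf (hypergeometric_pmf (N (Suc n) \<omega>) (S n \<omega>) (H n \<omega>)) k \<partial>M)"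
    using X_hypergeometric[of n k]
    by (intro integral_cong_AE) (auto elim!: eventually_mono)
  finally show ?thesis .
qed

text \<open>The hypergeometric law puts no mass above the sample size. Testing it against the event
  \<open>N (Suc n) \<omega> < k\<close> shows, for each \<open>k\<close>, that this event meets
  \<open>X (Suc n) \<omega> = k\<close> in a null set only.\<close>

lemma AE_X_le_N: "AE \<omega> in M. \<forall>n. X (Suc n) \<omega> \<le> N (Suc n) \<omega>"
  unfolding AE_all_countable
proof
  fix n
  have [measurable]: "N (Suc n) \<in> measurable M (count_space UNIV)" "X (Suc n) \<in> measurable M (count_space UNIV)"
    using rv by auto
  have "AE \<omega> in M. \<not> (X (Suc n) \<omega> = k \<and> N (Suc n) \<omega> < k)" for k
  proof -
    define U where "U \<omega> = (if N (Suc n) \<omega> < k then 1 else 0 :: real)" for \<omega>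
    have U: "U \<in> borel_measurable (FN n)" unfolding U_def
      by (rule measurable_FN_fun3[where f = "\<lambda>i j l. if i < k then 1 else 0"])
    have [measurable]: "U \<in> borel_measurable M" using FN.measurable_M[OF U] .
    have Ui: "integrable M U" by (rule integrable_const_bound[of _ 1]) (auto simp: U_def)
    let ?E = "{\<omega> \<in> space M. X (Suc n) \<omega> = k \<and> N (Suc n) \<omega> < k}"
    have "prob ?E = (\<integral>\<omega>. indicator ?E \<omega> \<partial>M)" by simp
    also have "\<dots> = (\<integral>\<omega>. U \<omega> * indicator {\<omega> \<in> space M. X (Suc n) \<omega> = k} \<omega> \<partial>M)"
      by (intro Bochner_Integration.integral_cong) (auto simp: U_def indicator_def)
    also have "\<dots> = (\<integral>\<omega>. U \<omega> * pmf (hypergeometric_pmf (N (Suc n) \<omega>) (S n \<omega>) (H n \<omega>)) k \<partial>M)"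
      by (rule integral_X_indicator[OF U Ui])
    also have "\<dots> = (\<integral>\<omega>. 0 \<partial>M)"
    proof (rule integral_cong_AE)
      show "AE \<omega> in M. U \<omega> * pmf (hypergeometric_pmf (N (Suc n) \<omega>) (S n \<omega>) (H n \<omega>)) k = 0"
        using AE_N_range by eventually_elim (auto simp: U_def pmf_hypergeometric)
      show "(\<lambda>\<omega>. U \<omega> * pmf (hypergeometric_pmf (N (Suc n) \<omega>) (S n \<omega>) (H n \<omega>)) k) \<in> borel_measurable M"
        using FN.measurable_M[OF measurable_FN_fun3[where f = "\<lambda>i j l. pmf (hypergeometric_pmf i j l) k"]]
        by measurable
    qed simp
    finally have "prob ?E = 0" by simp
    moreover have "?E \<in> events" by measurable
    ultimately have "AE \<omega> in M. \<omega> \<notin> ?E" by (simp add: prob_eq_0)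
    thus ?thesis using AE_space by eventually_elim auto
  qed
  hence "AE \<omega> in M. \<forall>k. \<not> (X (Suc n) \<omega> = k \<and> N (Suc n) \<omega> < k)" by (simp only: AE_all_countable) simp
  thus "AE \<omega> in M. X (Suc n) \<omega> \<le> N (Suc n) \<omega>" by eventually_elim auto
qed

lemma H_ge_1: "1 \<le> H n \<omega>" and K_ge_1: "1 \<le> K n \<omega>"
  using init by (auto simp: urn_H_def urn_K_def)

text \<open>Each drawn ball brings at most \<open>C\<close> new ones, and at most \<open>C\<close>
  balls are drawn per step.\<close>

lemma AE_S_le: "AE \<omega> in M. \<forall>n. S n \<omega> \<le> a + b + C * C * n"
  using AE_le_C AE_X_le_N
proof eventually_elim
  case (elim \<omega>)
  show ?case
  proof
    fix n
    show "S n \<omega> \<le> a + b + C * C * n"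
    proof (induction n)
      case 0
      then show ?case by (simp add: urn_H_def urn_K_def)
    next
      case (Suc n)
      let ?X = "X (Suc n) \<omega>" and ?N = "N (Suc n) \<omega>"
      have le: "A (Suc n) \<omega> \<le> C" "B (Suc n) \<omega> \<le> C" "?N \<le> C" "?X \<le> ?N"
        using elim by auto
      have "A (Suc n) \<omega> * ?X + B (Suc n) \<omega> * (?N - ?X) \<le> C * ?X + C * (?N - ?X)"
        using le by (intro add_mono mult_right_mono) auto
      also have "\<dots> = C * ?N" using le by (simp add: distrib_left[symmetric])
      also have "\<dots> \<le> C * C" using le by simp
      finally show ?case using Suc by (simp add: urn_H_def urn_K_def)
    qed
  qed
qed

text \<open>\<open>\<phi>\<close> is split according to the finitely many values
  \<open>k \<le> C\<close> of the draw, and each indicator is traded for its conditional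
  probability. The formula \<open>g\<close> is asked for only when \<open>2 \<le> s\<close>, since
  both colours are always present; this admits a factor \<open>s - 1\<close> in the
  denominator.\<close>

lemma integral_hypergeometric:
  fixes \<phi> :: "nat \<Rightarrow> nat \<Rightarrow> real" and g :: "nat \<Rightarrow> nat \<Rightarrow> nat \<Rightarrow> real"
  assumes bd: "\<And>m k. k \<le> m \<Longrightarrow> m \<le> C \<Longrightarrow> \<bar>\<phi> m k\<bar> \<le> r"
    and g: "\<And>m s h. m \<le> s \<Longrightarrow> h \<le> s \<Longrightarrow> 2 \<le> s \<Longrightarrow>
              (\<Sum>k\<le>m. \<phi> m k * pmf (hypergeometric_pmf m s h) k) = g m s h"
    and U: "U \<in> borel_measurable (FN n)" "integrable M U"
  shows "(\<integral>\<omega>. U \<omega> * \<phi> (N (Suc n) \<omega>) (X (Suc n) \<omega>) \<partial>M)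
       = (\<integral>\<omega>. U \<omega> * g (N (Suc n) \<omega>) (S n \<omega>) (H n \<omega>) \<partial>M)"
proof -
  \<comment> \<open>\<open>\<phi>\<close> is bounded only on the range that occurs almost surely;
    \<open>\<psi>\<close> is 0 elsewhere, so that its products with \<open>U\<close> are
    integrable.\<close>
  define \<psi> where "\<psi> m k = (if k \<le> m \<and> m \<le> C then \<phi> m k else 0)" for m k
  have \<psi>_bd: "\<bar>\<psi> m k\<bar> \<le> \<bar>r\<bar>" for m k using bd[of k m] by (auto simp: \<psi>_def)
  let ?I = "\<lambda>k. indicator {\<omega> \<in> space M. X (Suc n) \<omega> = k} :: 'w \<Rightarrow> real"
  let ?p = "\<lambda>k \<omega>. pmf (hypergeometric_pmf (N (Suc n) \<omega>) (S n \<omega>) (H n \<omega>)) k"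
  let ?N = "N (Suc n)" and ?X = "X (Suc n)"
  have \<psi>_FN: "(\<lambda>\<omega>. \<psi> (?N \<omega>) k) \<in> borel_measurable (FN n)" for k
    by (rule measurable_FN_fun3[where f = "\<lambda>i j l. \<psi> i k"])
  have meas[measurable]: "U \<in> borel_measurable M" "(\<lambda>\<omega>. \<psi> (?N \<omega>) k) \<in> borel_measurable M"
    "?p k \<in> borel_measurable M" "(\<lambda>\<omega>. \<phi> (?N \<omega>) (?X \<omega>)) \<in> borel_measurable M"
    "(\<lambda>\<omega>. g (?N \<omega>) (S n \<omega>) (H n \<omega>)) \<in> borel_measurable M"
    "?X \<in> measurable M (count_space UNIV)" for k
    using U(2) FN.measurable_M[OF \<psi>_FN] FN.measurable_M[OF measurable_FN_fun3[where f = "\<lambda>i j l. pmf (hypergeometric_pmf i j l) k"]]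
      FX.measurable_M[OF measurable_FX_fun2[of \<phi>]] FN.measurable_M[OF measurable_FN_fun3[where f = g]] rv(2)[of "Suc n"]
    by auto
  have U\<psi>: "integrable M (\<lambda>\<omega>. U \<omega> * \<psi> (?N \<omega>) k)" for k
  proof (rule Bochner_Integration.integrable_bound)
    show "integrable M (\<lambda>\<omega>. \<bar>r\<bar> * U \<omega>)" using U by simp
    show "AE \<omega> in M. norm (U \<omega> * \<psi> (?N \<omega>) k) \<le> norm (\<bar>r\<bar> * U \<omega>)"
      using \<psi>_bd by (auto simp: abs_mult mult.commute[of "\<bar>r\<bar>"] intro!: mult_left_mono)
  qed measurable
  have i1: "integrable M (\<lambda>\<omega>. (U \<omega> * \<psi> (?N \<omega>) k) * ?I k \<omega>)" for k
    by (rule Bochner_Integration.integrable_bound[OF U\<psi>[of k]]) (auto split: split_indicator)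
  have i2: "integrable M (\<lambda>\<omega>. (U \<omega> * \<psi> (?N \<omega>) k) * ?p k \<omega>)" for k
    by (rule Bochner_Integration.integrable_bound[OF U\<psi>[of k]])
       (auto simp: abs_mult pmf_le_1 intro!: mult_left_le)
  have "(\<integral>\<omega>. U \<omega> * \<phi> (?N \<omega>) (?X \<omega>) \<partial>M) = (\<integral>\<omega>. (\<Sum>k\<le>C. (U \<omega> * \<psi> (?N \<omega>) k) * ?I k \<omega>) \<partial>M)"
  proof (rule integral_cong_AE)
    show "AE \<omega> in M. U \<omega> * \<phi> (?N \<omega>) (?X \<omega>) = (\<Sum>k\<le>C. (U \<omega> * \<psi> (?N \<omega>) k) * ?I k \<omega>)"
      using AE_X_le_N AE_le_C AE_space
    proof eventually_elim
      case (elim \<omega>)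
      have le: "?X \<omega> \<le> ?N \<omega>" "?N \<omega> \<le> C" using elim by auto
      have "(\<Sum>k\<le>C. (U \<omega> * \<psi> (?N \<omega>) k) * ?I k \<omega>) = (\<Sum>k\<le>C. if k = ?X \<omega> then U \<omega> * \<psi> (?N \<omega>) k else 0)"
        using elim(3) by (intro sum.cong) auto
      also have "\<dots> = U \<omega> * \<psi> (?N \<omega>) (?X \<omega>)" using le by simp
      finally show ?case using le by (simp add: \<psi>_def)
    qed
  qed measurable
  also have "\<dots> = (\<Sum>k\<le>C. \<integral>\<omega>. (U \<omega> * \<psi> (?N \<omega>) k) * ?I k \<omega> \<partial>M)"
    by (rule Bochner_Integration.integral_sum) (rule i1)
  also have "\<dots> = (\<Sum>k\<le>C. \<integral>\<omega>. (U \<omega> * \<psi> (?N \<omega>) k) * ?p k \<omega> \<partial>M)"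
    using U(1) \<psi>_FN by (intro sum.cong refl integral_X_indicator[OF _ U\<psi>]) (rule borel_measurable_times)
  also have "\<dots> = (\<integral>\<omega>. (\<Sum>k\<le>C. (U \<omega> * \<psi> (?N \<omega>) k) * ?p k \<omega>) \<partial>M)"
    by (rule Bochner_Integration.integral_sum[symmetric]) (rule i2)
  also have "\<dots> = (\<integral>\<omega>. U \<omega> * g (?N \<omega>) (S n \<omega>) (H n \<omega>) \<partial>M)"
  proof (rule integral_cong_AE)
    show "AE \<omega> in M. (\<Sum>k\<le>C. (U \<omega> * \<psi> (?N \<omega>) k) * ?p k \<omega>) = U \<omega> * g (?N \<omega>) (S n \<omega>) (H n \<omega>)"
      using AE_N_range AE_le_C
    proof eventually_elim
      case (elim \<omega>)
      have le: "?N \<omega> \<le> C" "?N \<omega> \<le> S n \<omega>" using elim by auto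
      have "(\<Sum>k\<le>C. (U \<omega> * \<psi> (?N \<omega>) k) * ?p k \<omega>) = (\<Sum>k\<le>?N \<omega>. (U \<omega> * \<psi> (?N \<omega>) k) * ?p k \<omega>)"
        using le by (intro sum.mono_neutral_right) (auto simp: \<psi>_def)
      also have "\<dots> = U \<omega> * (\<Sum>k\<le>?N \<omega>. \<phi> (?N \<omega>) k * ?p k \<omega>)"
        using le unfolding sum_distrib_left by (intro sum.cong) (auto simp: \<psi>_def)
      also have "\<dots> = U \<omega> * g (?N \<omega>) (S n \<omega>) (H n \<omega>)"
        using le H_ge_1[of n \<omega>] K_ge_1[of n \<omega>] by (subst g) auto
      finally show ?case .
    qed
  qed measurable
  finally show ?thesis .
qed

text \<open>Where the compensator diverges, the ratio of the sum to it tends to 1, so the sum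
  diverges too. Being a mean of \<open>\<phi>\<close>, \<open>g\<close> inherits the bounds 0 and
  \<open>r\<close>.\<close>

lemma AE_hypergeometric_sum_at_top:
  fixes \<phi> :: "nat \<Rightarrow> nat \<Rightarrow> real" and g :: "nat \<Rightarrow> nat \<Rightarrow> nat \<Rightarrow> real"
  assumes bd: "\<And>m k. k \<le> m \<Longrightarrow> m \<le> C \<Longrightarrow> 0 \<le> \<phi> m k \<and> \<phi> m k \<le> r"
    and g: "\<And>m s h. m \<le> s \<Longrightarrow> h \<le> s \<Longrightarrow> 2 \<le> s \<Longrightarrow>
              (\<Sum>k\<le>m. \<phi> m k * pmf (hypergeometric_pmf m s h) k) = g m s h"
  shows "AE \<omega> in M.
    filterlim (\<lambda>n. \<Sum>j<n. g (N (Suc j) \<omega>) (S j \<omega>) (H j \<omega>)) at_top sequentially \<longrightarrow>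
    filterlim (\<lambda>n. \<Sum>j<n. \<phi> (N (Suc j) \<omega>) (X (Suc j) \<omega>)) at_top sequentially"
proof -
  have "AE \<omega> in M.
    filterlim (\<lambda>n. \<Sum>j<n. g (N (Suc j) \<omega>) (S j \<omega>) (H j \<omega>)) at_top sequentially \<longrightarrow>
    (\<lambda>n. (\<Sum>j<n. \<phi> (N (Suc j) \<omega>) (X (Suc j) \<omega>)) / (\<Sum>j<n. g (N (Suc j) \<omega>) (S j \<omega>) (H j \<omega>))) \<longlonglongrightarrow> 1"
  proof (rule FN.AE_ratio_to_compensator[where c = r])
    fix n
    show "(\<lambda>\<omega>. \<phi> (N (Suc n) \<omega>) (X (Suc n) \<omega>)) \<in> borel_measurable (FN (Suc n))"
      by (intro measurable_F_FN measurable_FX_F measurable_FX_fun2)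
    show "(\<lambda>\<omega>. g (N (Suc n) \<omega>) (S n \<omega>) (H n \<omega>)) \<in> borel_measurable (FN n)"
      by (rule measurable_FN_fun3)
    show "AE \<omega> in M. 0 \<le> \<phi> (N (Suc n) \<omega>) (X (Suc n) \<omega>) \<and> \<phi> (N (Suc n) \<omega>) (X (Suc n) \<omega>) \<le> r"
      using AE_X_le_N AE_le_C by eventually_elim (auto intro!: bd)
    show "AE \<omega> in M. 0 \<le> g (N (Suc n) \<omega>) (S n \<omega>) (H n \<omega>) \<and> g (N (Suc n) \<omega>) (S n \<omega>) (H n \<omega>) \<le> r"
      using AE_N_range AE_le_C
    proof eventually_elim
      case (elim \<omega>)
      let ?p = "\<lambda>k. pmf (hypergeometric_pmf (N (Suc n) \<omega>) (S n \<omega>) (H n \<omega>)) k"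
      have le: "N (Suc n) \<omega> \<le> C" "N (Suc n) \<omega> \<le> S n \<omega>" using elim by auto
      have eq: "g (N (Suc n) \<omega>) (S n \<omega>) (H n \<omega>) = (\<Sum>k\<le>N (Suc n) \<omega>. \<phi> (N (Suc n) \<omega>) k * ?p k)"
        using le H_ge_1[of n \<omega>] K_ge_1[of n \<omega>] by (subst g) auto
      have "(\<Sum>k\<le>N (Suc n) \<omega>. \<phi> (N (Suc n) \<omega>) k * ?p k) \<le> (\<Sum>k\<le>N (Suc n) \<omega>. r * ?p k)"
        using bd le by (intro sum_mono mult_right_mono) auto
      also have "\<dots> = r" unfolding sum_distrib_left[symmetric] using le by (subst hypergeometric_total) auto
      finally have "(\<Sum>k\<le>N (Suc n) \<omega>. \<phi> (N (Suc n) \<omega>) k * ?p k) \<le> r" .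
      moreover have "0 \<le> (\<Sum>k\<le>N (Suc n) \<omega>. \<phi> (N (Suc n) \<omega>) k * ?p k)"
        using bd le by (intro sum_nonneg mult_nonneg_nonneg) auto
      ultimately show ?case unfolding eq by simp
    qed
    show "(\<integral>\<omega>. U \<omega> * \<phi> (N (Suc n) \<omega>) (X (Suc n) \<omega>) \<partial>M) = (\<integral>\<omega>. U \<omega> * g (N (Suc n) \<omega>) (S n \<omega>) (H n \<omega>) \<partial>M)"
      if "U \<in> borel_measurable (FN n)" "integrable M U" for U
      by (rule integral_hypergeometric[OF _ g that, where r = r]) (use bd in force)+
  qed
  thus ?thesis
  proof eventually_elim
    case (elim \<omega>)
    show ?case
    proof
      assume div: "filterlim (\<lambda>n. \<Sum>j<n. g (N (Suc j) \<omega>) (S j \<omega>) (H j \<omega>)) at_top sequentially"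
      define y where "y n = (\<Sum>j<n. \<phi> (N (Suc j) \<omega>) (X (Suc j) \<omega>))" for n
      define W where "W n = (\<Sum>j<n. g (N (Suc j) \<omega>) (S j \<omega>) (H j \<omega>))" for n
      have W: "filterlim W at_top sequentially" using div by (simp add: W_def[abs_def])
      have "(\<lambda>n. y n / W n) \<longlonglongrightarrow> 1" using elim div by (simp add: y_def W_def)
      from filterlim_tendsto_pos_mult_at_top[OF this _ W]
      have "filterlim (\<lambda>n. y n / W n * W n) at_top sequentially" by simp
      moreover have "\<forall>\<^sub>F n in sequentially. W n > 0" using W by (simp add: filterlim_at_top_dense)
      hence "\<forall>\<^sub>F n in sequentially. y n / W n * W n = y n" by eventually_elim simp
      ultimately have "filterlim y at_top sequentially"
        by (rule filterlim_cong[OF refl refl, THEN iffD1, rotated])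
      thus "filterlim (\<lambda>n. \<Sum>j<n. \<phi> (N (Suc j) \<omega>) (X (Suc j) \<omega>)) at_top sequentially"
        by (simp add: y_def[abs_def])
    qed
  qed
qed

section \<open>Divergence of the drawn totals\<close>

lemma inverse_S_ge:
  obtains \<delta> :: real where "\<delta> > 0" "AE \<omega> in M. \<forall>n. \<delta> / (real n + 2) \<le> 1 / real (S n \<omega>)"
proof
  \<comment> \<open>From \<open>a + b + C * C * n \<le> (a + b + C * C) * (n + 2)\<close>; the
    factor \<open>n + 2\<close> is the one in \<open>sums_at_top_of_average\<close>.\<close>
  let ?d = "1 / real (a + b + C * C)"
  have ab: "a + b + C * C > 0" using init by simp
  thus "?d > 0" by (simp only: zero_less_divide_1_iff of_nat_0_less_iff)
  show "AE \<omega> in M. \<forall>n. ?d / (real n + 2) \<le> 1 / real (S n \<omega>)"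
    using AE_S_le
  proof eventually_elim
    case (elim \<omega>)
    show ?case
    proof
      fix n
      have "S n \<omega> \<le> a + b + C * C * n" using elim by blast
      also have "\<dots> \<le> (a + b + C * C) * (n + 2)" by (simp add: algebra_simps)
      finally have "real (S n \<omega>) \<le> real ((a + b + C * C) * (n + 2))" by (simp only: of_nat_le_iff)
      also have "\<dots> = real (a + b + C * C) * (real n + 2)" by (simp only: of_nat_mult of_nat_add of_nat_numeral)
      finally have "real (S n \<omega>) \<le> real (a + b + C * C) * (real n + 2)" .
      moreover have "real (S n \<omega>) > 0" using H_ge_1[of n \<omega>] by simp
      moreover have "1 / (real (a + b + C * C) * (real n + 2)) = ?d / (real n + 2)" by simp
      ultimately show "?d / (real n + 2) \<le> 1 / real (S n \<omega>)"
        by (metis frac_le order_refl zero_le_one)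
    qed
  qed
qed

text \<open>The conditional mean is at least \<open>1 / S n\<close>, because at least one ball is
  drawn and a ball of color A is present; this is compared with the harmonic series.\<close>

lemma AE_sum_X_at_top: "AE \<omega> in M. filterlim (\<lambda>n. \<Sum>j<n. real (X (Suc j) \<omega>)) at_top sequentially"
proof -
  obtain \<delta> :: real where \<delta>: "\<delta> > 0" "AE \<omega> in M. \<forall>n. \<delta> / (real n + 2) \<le> 1 / real (S n \<omega>)"
    by (rule inverse_S_ge)
  have "AE \<omega> in M. filterlim (\<lambda>n. \<Sum>j<n. real (N (Suc j) \<omega>) * real (H j \<omega>) / real (S j \<omega>)) at_top sequentially \<longrightarrow>
      filterlim (\<lambda>n. \<Sum>j<n. real (X (Suc j) \<omega>)) at_top sequentially"
    by (rule AE_hypergeometric_sum_at_top[where \<phi> = "\<lambda>m k. real k" and r = "real C"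
          and g = "\<lambda>m s h. real m * real h / real s"]) (auto intro: hypergeometric_mean)
  thus ?thesis using \<delta>(2) AE_N_range
  proof eventually_elim
    case (elim \<omega>)
    have "filterlim (\<lambda>n. \<Sum>j<n. real (N (Suc j) \<omega>) * real (H j \<omega>) / real (S j \<omega>)) at_top sequentially"
    proof (rule sums_at_top_of_average[where x = "\<lambda>_. 1" and l = 1 and \<delta> = \<delta>])
      show "(\<lambda>n. (\<Sum>j<n. 1) / real n) \<longlonglongrightarrow> 1"
        by (rule tendsto_eventually, rule eventually_mono[OF eventually_gt_at_top[of 0]]) simp
      fix n
      have "1 \<le> real (N (Suc n) \<omega>)" "1 \<le> real (H n \<omega>)" using elim H_ge_1[of n \<omega>] by auto
      hence "1 * 1 \<le> real (N (Suc n) \<omega>) * real (H n \<omega>)" by (intro mult_mono) auto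
      hence "1 / real (S n \<omega>) \<le> real (N (Suc n) \<omega>) * real (H n \<omega>) / real (S n \<omega>)"
        by (intro divide_right_mono) auto
      thus "\<delta> * 1 / (real n + 2) \<le> real (N (Suc n) \<omega>) * real (H n \<omega>) / real (S n \<omega>)"
        using elim(2)[rule_format, of n] by simp
    qed (use \<delta> in auto)
    thus ?case using elim(1) by blast
  qed
qed

text \<open>The mirror image, with \<open>K n = S n - H n \<ge> 1\<close> in place of
  \<open>H n\<close>.\<close>

lemma AE_sum_N_minus_X_at_top:
  "AE \<omega> in M. filterlim (\<lambda>n. \<Sum>j<n. real (N (Suc j) \<omega>) - real (X (Suc j) \<omega>)) at_top sequentially"
proof -
  obtain \<delta> :: real where \<delta>: "\<delta> > 0" "AE \<omega> in M. \<forall>n. \<delta> / (real n + 2) \<le> 1 / real (S n \<omega>)"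
    by (rule inverse_S_ge)
  let ?w = "\<lambda>\<omega> j. real (N (Suc j) \<omega>) * (real (S j \<omega>) - real (H j \<omega>)) / real (S j \<omega>)"
  have "AE \<omega> in M. filterlim (\<lambda>n. \<Sum>j<n. ?w \<omega> j) at_top sequentially \<longrightarrow>
      filterlim (\<lambda>n. \<Sum>j<n. real (N (Suc j) \<omega>) - real (X (Suc j) \<omega>)) at_top sequentially"
    by (rule AE_hypergeometric_sum_at_top[where \<phi> = "\<lambda>m k. real m - real k" and r = "real C"
          and g = "\<lambda>m s h. real m * (real s - real h) / real s"]) (auto intro: hypergeometric_mean_complement)
  thus ?thesis using \<delta>(2) AE_N_range
  proof eventually_elim
    case (elim \<omega>)
    have "filterlim (\<lambda>n. \<Sum>j<n. ?w \<omega> j) at_top sequentially"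
    proof (rule sums_at_top_of_average[where x = "\<lambda>_. 1" and l = 1 and \<delta> = \<delta>])
      show "(\<lambda>n. (\<Sum>j<n. 1) / real n) \<longlonglongrightarrow> 1"
        by (rule tendsto_eventually, rule eventually_mono[OF eventually_gt_at_top[of 0]]) simp
      fix n
      have "1 \<le> real (N (Suc n) \<omega>)" "1 \<le> real (K n \<omega>)" using elim K_ge_1[of n \<omega>] by auto
      hence "1 * 1 \<le> real (N (Suc n) \<omega>) * real (K n \<omega>)" by (intro mult_mono) auto
      hence "1 / real (S n \<omega>) \<le> ?w \<omega> n"
        by (intro divide_right_mono) auto
      thus "\<delta> * 1 / (real n + 2) \<le> ?w \<omega> n"
        using elim(2)[rule_format, of n] by simp
    qed (use \<delta> in auto)
    thus ?case using elim(1) by blast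
  qed
qed

text \<open>Draws of size 1 contribute nothing, so the divergence criterion is fed with
  \<open>N - 1\<close>, whose averages tend to \<open>l - 1 > 0\<close>. \<open>l\<close> is
  quantified inside the almost sure statement so that a random limit can be substituted for
  it.\<close>

lemma AE_sum_product_at_top:
  "AE \<omega> in M. \<forall>l>1. (\<lambda>n. (\<Sum>j<n. real (N (Suc j) \<omega>)) / real n) \<longlonglongrightarrow> l \<longrightarrow>
     filterlim (\<lambda>n. \<Sum>j<n. real (X (Suc j) \<omega>) * (real (N (Suc j) \<omega>) - real (X (Suc j) \<omega>))) at_top sequentially"
proof -
  obtain \<delta> :: real where \<delta>: "\<delta> > 0" "AE \<omega> in M. \<forall>n. \<delta> / (real n + 2) \<le> 1 / real (S n \<omega>)"
    by (rule inverse_S_ge)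
  let ?g = "\<lambda>m s h. real m * (real m - 1) * (real h * (real s - real h)) / (real s * (real s - 1))"
  let ?w = "\<lambda>\<omega> j. ?g (N (Suc j) \<omega>) (S j \<omega>) (H j \<omega>)"
  have "AE \<omega> in M. filterlim (\<lambda>n. \<Sum>j<n. ?w \<omega> j) at_top sequentially \<longrightarrow>
      filterlim (\<lambda>n. \<Sum>j<n. real (X (Suc j) \<omega>) * (real (N (Suc j) \<omega>) - real (X (Suc j) \<omega>))) at_top sequentially"
  proof (rule AE_hypergeometric_sum_at_top[where \<phi> = "\<lambda>m k. real k * (real m - real k)"
          and r = "real C * real C" and g = ?g])
    fix m k assume "k \<le> m" "m \<le> C"
    thus "0 \<le> real k * (real m - real k) \<and> real k * (real m - real k) \<le> real C * real C"
      by (auto intro!: mult_mono)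
  qed (rule hypergeometric_mean_product)
  thus ?thesis using \<delta>(2) AE_N_range
  proof eventually_elim
    case (elim \<omega>)
    show ?case
    proof (intro allI impI)
      fix l :: real
      assume l: "l > 1" and lim: "(\<lambda>n. (\<Sum>j<n. real (N (Suc j) \<omega>)) / real n) \<longlonglongrightarrow> l"
      have "filterlim (\<lambda>n. \<Sum>j<n. ?w \<omega> j) at_top sequentially"
      proof (rule sums_at_top_of_average[where x = "\<lambda>n. real (N (Suc n) \<omega>) - 1" and l = "l - 1" and \<delta> = \<delta>])
        have "(\<lambda>n. (\<Sum>j<n. real (N (Suc j) \<omega>)) / real n - 1) \<longlonglongrightarrow> l - 1"
          by (intro tendsto_intros lim)
        moreover have "\<forall>\<^sub>F n in sequentially. (\<Sum>j<n. real (N (Suc j) \<omega>)) / real n - 1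
            = (\<Sum>j<n. real (N (Suc j) \<omega>) - 1) / real n"
          using eventually_gt_at_top[of 0] by eventually_elim (simp add: sum_subtractf field_simps)
        ultimately show "(\<lambda>n. (\<Sum>j<n. real (N (Suc j) \<omega>) - 1) / real n) \<longlonglongrightarrow> l - 1"
          by (rule Lim_transform_eventually)
        fix n
        define m where "m = real (N (Suc n) \<omega>)"
        define h where "h = real (H n \<omega>)"
        define k where "k = real (K n \<omega>)"
        have 1: "m \<ge> 1" "h \<ge> 1" "k \<ge> 1"
          using elim H_ge_1[of n \<omega>] K_ge_1[of n \<omega>] by (auto simp: m_def h_def k_def)
        show "0 \<le> real (N (Suc n) \<omega>) - 1" using 1 by (simp add: m_def)
        have "0 \<le> (h - 1) * (k - 1)" using 1 by simp
        \<comment> \<open>With \<open>s = h + k\<close> this bounds \<open>h * k\<close> below by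
          \<open>s - 1\<close>, which cancels the same factor in the denominator of the mean and
          leaves \<open>(m - 1) / s\<close>.\<close>
        hence hk: "h + k - 1 \<le> h * k" by (simp add: algebra_simps)
        have "(m - 1) * (1 / (h + k)) = (m - 1) * (h + k - 1) / ((h + k) * (h + k - 1))"
          using 1 by simp
        also have "\<dots> \<le> m * (m - 1) * (h * k) / ((h + k) * (h + k - 1))"
        proof (rule divide_right_mono)
          have "1 * ((m - 1) * (h + k - 1)) \<le> m * ((m - 1) * (h * k))"
            using 1 hk by (intro mult_mono mult_nonneg_nonneg) auto
          thus "(m - 1) * (h + k - 1) \<le> m * (m - 1) * (h * k)" by (simp add: mult.assoc)
        qed (use 1 in simp)
        also have "\<dots> = ?w \<omega> n" by (simp add: m_def h_def k_def)
        finally have "(m - 1) * (1 / real (S n \<omega>)) \<le> ?w \<omega> n" by (simp add: h_def k_def)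
        moreover have "(m - 1) * (\<delta> / (real n + 2)) \<le> (m - 1) * (1 / real (S n \<omega>))"
          using 1 elim(2) by (intro mult_left_mono) auto
        ultimately show "\<delta> * (real (N (Suc n) \<omega>) - 1) / (real n + 2) \<le> ?w \<omega> n"
          by (simp add: m_def mult.commute)
      qed (use \<delta> l in auto)
      thus "filterlim (\<lambda>n. \<Sum>j<n. real (X (Suc j) \<omega>) * (real (N (Suc j) \<omega>) - real (X (Suc j) \<omega>))) at_top sequentially"
        using elim(1) by blast
    qed
  qed
qed

text \<open>The bound \<open>1 \<le> \<phi> m\<close> makes the sums of the conditional means
  diverge, so the sums of \<open>\<phi> (N j)\<close> are asymptotic to them; Cesaro averaging of
  the convergent conditional means then gives \<open>L\<close>.\<close>

lemma AE_average_tendsto_cond_exp_limit: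
  fixes \<phi> :: "nat \<Rightarrow> real"
  assumes \<phi>: "\<And>m. 1 \<le> m \<Longrightarrow> m \<le> C \<Longrightarrow> 1 \<le> \<phi> m \<and> \<phi> m \<le> r"
    and lim: "AE \<omega> in M. (\<lambda>n. real_cond_exp M (F n) (\<lambda>\<omega>. \<phi> (N (Suc n) \<omega>)) \<omega>) \<longlonglongrightarrow> L \<omega>"
  shows "AE \<omega> in M. (\<lambda>n. (\<Sum>j<n. \<phi> (N (Suc j) \<omega>)) / real n) \<longlonglongrightarrow> L \<omega>"
proof -
  define Y where "Y n \<omega> = \<phi> (N (Suc n) \<omega>)" for n \<omega>
  define w where "w n = real_cond_exp M (F n) (Y n)" for n
  have Y_FN: "Y n \<in> borel_measurable (FN n)" for n
    unfolding Y_def by (rule measurable_FN_fun3[where f = "\<lambda>i j l. \<phi> i"])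
  have [measurable]: "Y n \<in> borel_measurable M" for n using FN.measurable_M[OF Y_FN] .
  have Y_bd: "AE \<omega> in M. 1 \<le> Y n \<omega> \<and> Y n \<omega> \<le> r" for n
    using AE_N_range AE_le_C unfolding Y_def by eventually_elim (rule \<phi>, auto)
  have Y_int: "integrable M (Y n)" for n
  proof (rule integrable_AE_bounded)
    show "AE \<omega> in M. \<bar>Y n \<omega>\<bar> \<le> r" using Y_bd[of n] by eventually_elim simp
  qed measurable
  have sub: "finite_measure_subalgebra M (F n)" for n
    by unfold_locales (rule F.subalg)
  hence sub': "sigma_finite_subalgebra M (F n)" for n
    by (rule finite_measure_subalgebra_is_sigma_finite)
  have w_bd: "AE \<omega> in M. 1 \<le> w n \<omega> \<and> w n \<omega> \<le> r" for n
  proof -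
    have "AE \<omega> in M. 1 \<le> Y n \<omega>" "AE \<omega> in M. Y n \<omega> \<le> r" using Y_bd[of n] by (auto elim: eventually_mono)
    hence "AE \<omega> in M. 1 \<le> w n \<omega>" "AE \<omega> in M. w n \<omega> \<le> r"
      unfolding w_def
      using sigma_finite_subalgebra.real_cond_exp_ge_c[OF sub' Y_int]
        sigma_finite_subalgebra.real_cond_exp_le_c[OF sub' Y_int] by auto
    thus ?thesis by eventually_elim simp
  qed
  have "AE \<omega> in M. filterlim (\<lambda>n. \<Sum>j<n. w j \<omega>) at_top sequentially \<longrightarrow>
           (\<lambda>n. (\<Sum>j<n. Y j \<omega>) / (\<Sum>j<n. w j \<omega>)) \<longlonglongrightarrow> 1"
  proof (rule F.AE_ratio_to_compensator[where c = r])
    fix n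
    show "Y n \<in> borel_measurable (F (Suc n))"
      by (rule measurable_FX_F[OF measurable_FN_FX[OF Y_FN]])
    show "w n \<in> borel_measurable (F n)" unfolding w_def by simp
    show "AE \<omega> in M. 0 \<le> Y n \<omega> \<and> Y n \<omega> \<le> r" using Y_bd[of n] by eventually_elim simp
    show "AE \<omega> in M. 0 \<le> w n \<omega> \<and> w n \<omega> \<le> r" using w_bd[of n] by eventually_elim simp
    fix U :: "'w \<Rightarrow> real" assume U: "U \<in> borel_measurable (F n)" "integrable M U"
    have "integrable M (\<lambda>\<omega>. U \<omega> * Y n \<omega>)"
    proof (rule Bochner_Integration.integrable_bound)
      show "integrable M (\<lambda>\<omega>. r * U \<omega>)" using U by simp
      show "(\<lambda>\<omega>. U \<omega> * Y n \<omega>) \<in> borel_measurable M" using U(2) by measurable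
      show "AE \<omega> in M. norm (U \<omega> * Y n \<omega>) \<le> norm (r * U \<omega>)"
        using Y_bd[of n] by eventually_elim (auto simp: abs_mult mult.commute[of r] intro!: mult_left_mono)
    qed
    thus "(\<integral>\<omega>. U \<omega> * Y n \<omega> \<partial>M) = (\<integral>\<omega>. U \<omega> * w n \<omega> \<partial>M)"
      unfolding w_def using sigma_finite_subalgebra.real_cond_exp_intg(2)[OF sub' _ U(1)] by simp
  qed
  moreover have "AE \<omega> in M. \<forall>n. 1 \<le> w n \<omega>"
    unfolding AE_all_countable
  proof
    fix n show "AE \<omega> in M. 1 \<le> w n \<omega>" using w_bd[of n] by eventually_elim simp
  qed
  moreover have "AE \<omega> in M. (\<lambda>n. w n \<omega>) \<longlonglongrightarrow> L \<omega>"
    using lim by (simp add: w_def Y_def[abs_def])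
  ultimately show ?thesis
  proof eventually_elim
    case (elim \<omega>)
    have ge: "real n \<le> (\<Sum>j<n. w j \<omega>)" for n
      using sum_mono[of "{..<n}" "\<lambda>_. 1" "\<lambda>j. w j \<omega>"] elim(2) by simp
    have "filterlim (\<lambda>n. \<Sum>j<n. w j \<omega>) at_top sequentially"
      by (rule filterlim_at_top_mono[OF filterlim_real_sequentially]) (simp add: ge)
    hence 1: "(\<lambda>n. (\<Sum>j<n. Y j \<omega>) / (\<Sum>j<n. w j \<omega>)) \<longlonglongrightarrow> 1" using elim(1) by blast
    have 2: "(\<lambda>n. (\<Sum>j<n. w j \<omega>) / real n) \<longlonglongrightarrow> L \<omega>"
      using weighted_cesaro[of "\<lambda>_. 1", OF _ _ elim(3)] by (simp add: filterlim_real_sequentially)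
    have "(\<lambda>n. (\<Sum>j<n. Y j \<omega>) / (\<Sum>j<n. w j \<omega>) * ((\<Sum>j<n. w j \<omega>) / real n)) \<longlonglongrightarrow> 1 * L \<omega>"
      by (intro tendsto_mult 1 2)
    moreover have "\<forall>\<^sub>F n in sequentially. (\<Sum>j<n. Y j \<omega>) / (\<Sum>j<n. w j \<omega>) * ((\<Sum>j<n. w j \<omega>) / real n)
        = (\<Sum>j<n. Y j \<omega>) / real n"
      using eventually_gt_at_top[of 0]
    proof eventually_elim
      case (elim n)
      thus ?case using ge[of n] by simp
    qed
    ultimately have "(\<lambda>n. (\<Sum>j<n. Y j \<omega>) / real n) \<longlonglongrightarrow> 1 * L \<omega>" by (rule Lim_transform_eventually)
    thus ?case by (simp add: Y_def)
  qed
qed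

end

subsection \<open>Empirical means of the reinforcements\<close>

text \<open>The \<sigma>-algebras generated by \<open>f\<close> and \<open>g\<close> lie inside
  \<open>P\<close> and \<open>Q\<close>, so independence passes down to the two functions.\<close>

lemma (in prob_space) integral_mult_indep_subalgebras:
  fixes f g :: "'a \<Rightarrow> real"
  assumes indep: "indep_set (sets P) (sets Q)"
    and spaces: "space P = space M" "space Q = space M"
    and f: "f \<in> borel_measurable P" "integrable M f"
    and g: "g \<in> borel_measurable Q" "integrable M g"
  shows "(\<integral>x. f x * g x \<partial>M) = (\<integral>x. f x \<partial>M) * (\<integral>x. g x \<partial>M)"
proof (rule indep_var_lebesgue_integral)
  have sub: "sigma_sets (space M) {h -` S \<inter> space M |S. S \<in> sets borel} \<subseteq> sets R"
    if "h \<in> borel_measurable R" "space R = space M" for h :: "'a \<Rightarrow> real" and R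
    unfolding that(2)[symmetric] using measurable_sets[OF that(1)] by (intro sets.sigma_sets_subset) auto
  show "indep_var borel f borel g"
    unfolding indep_var_eq
  proof (intro conjI)
    show "indep_set (sigma_sets (space M) {f -` S \<inter> space M |S. S \<in> sets borel})
        (sigma_sets (space M) {g -` S \<inter> space M |S. S \<in> sets borel})"
      using indep sub[OF f(1) spaces(1)] sub[OF g(1) spaces(2)]
      unfolding indep_set_def by (elim indep_sets_mono_sets) (auto split: bool.split)
  qed (use f g in auto)
qed fact+

context urn_model
begin

text \<open>The weight \<open>v n\<close> is known before the reinforcement, which is independent of
  that past; so the centred reinforcement times \<open>v n\<close> is orthogonal to the past and the
  weighted strong law applies. The deterministic means \<open>m j\<close>, which may vary with
  \<open>j\<close>, are averaged by \<open>weighted_cesaro\<close>.\<close>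

lemma AE_weighted_mean_reinforcement:
  fixes f :: "nat \<Rightarrow> nat \<Rightarrow> real" and v :: "nat \<Rightarrow> 'w \<Rightarrow> real"
  assumes f_bd: "\<And>x y. x \<le> C \<Longrightarrow> y \<le> C \<Longrightarrow> \<bar>f x y\<bar> \<le> r"
    and v_meas: "\<And>n. v n \<in> borel_measurable (FX n)"
    and v_bd: "\<And>n. AE \<omega> in M. 0 \<le> v n \<omega> \<and> v n \<omega> \<le> c"
    and lim: "(\<lambda>n. \<integral>\<omega>. f (A n \<omega>) (B n \<omega>) \<partial>M) \<longlonglongrightarrow> q"
  shows "AE \<omega> in M. filterlim (\<lambda>n. \<Sum>j<n. v j \<omega>) at_top sequentially \<longrightarrow>
    (\<lambda>n. (\<Sum>j<n. f (A (Suc j) \<omega>) (B (Suc j) \<omega>) * v j \<omega>) / (\<Sum>j<n. v j \<omega>)) \<longlonglongrightarrow> q"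
proof -
  define Z where "Z n \<omega> = f (A (Suc n) \<omega>) (B (Suc n) \<omega>)" for n \<omega>
  define m where "m n = (\<integral>\<omega>. Z n \<omega> \<partial>M)" for n
  let ?AB = "\<lambda>n. gen_sigma M {A (Suc n), B (Suc n)}"
  have Z_AB: "Z n \<in> borel_measurable (?AB n)" for n
    unfolding Z_def by (rule measurable_of_nat_fun2[OF measurable_gen_sigma measurable_gen_sigma]) auto
  have Z_F: "Z n \<in> borel_measurable (F (Suc n))" for n
    unfolding Z_def by (rule measurable_of_nat_fun2[OF measurable_vars_F(3,4)]) auto
  have [measurable]: "Z n \<in> borel_measurable M" "v n \<in> borel_measurable M" for n
    using F.measurable_M[OF Z_F] FX.measurable_M[OF v_meas] by auto
  have Z_bd: "AE \<omega> in M. \<bar>Z n \<omega>\<bar> \<le> r" for n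
    unfolding Z_def using AE_le_C by eventually_elim (auto intro: f_bd)
  have r0: "r \<ge> 0" using f_bd[of 0 0] by linarith
  have c0: "c \<ge> 0"
  proof -
    have "AE \<omega> in M. 0 \<le> c" using v_bd[of 0] by eventually_elim linarith
    thus ?thesis by simp
  qed
  have Z_int: "integrable M (Z n)" for n
    by (rule integrable_AE_bounded[OF _ Z_bd]) measurable
  have m_bd: "\<bar>m n\<bar> \<le> r" for n
  proof -
    have "AE \<omega> in M. Z n \<omega> \<le> r" "AE \<omega> in M. - r \<le> Z n \<omega>"
      using Z_bd[of n] by (eventually_elim, linarith)+
    thus ?thesis using integral_le_const[OF Z_int[of n], of r] integral_ge_const[OF Z_int[of n], of "- r"]
      by (simp add: m_def abs_le_iff)
  qed
  have Zm_bd: "AE \<omega> in M. \<bar>Z n \<omega> - m n\<bar> \<le> 2 * r" for n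
    using Z_bd[of n]
  proof eventually_elim
    case (elim \<omega>)
    thus ?case using m_bd[of n] by linarith
  qed
  have m_lim: "m \<longlonglongrightarrow> q" using LIMSEQ_Suc[OF lim] by (simp add: m_def[abs_def] Z_def[abs_def])
  \<comment> \<open>One constant above three bounds: \<open>c\<close> for the weight,
    \<open>2 * r * c\<close> for the increment, and \<open>(2 * r)\<^sup>2 * c\<close> for the
    variance relative to the weight.\<close>
  define k where "k = c + 2 * r * c + (2 * r)\<^sup>2 * c"
  have k: "c \<le> k" "2 * r * c \<le> k" "(2 * r)\<^sup>2 * c \<le> k" using c0 r0 by (simp_all add: k_def)
  have "AE \<omega> in M. filterlim (\<lambda>n. \<Sum>j<n. v j \<omega>) at_top sequentially \<longrightarrow>
    (\<lambda>n. (\<Sum>j<n. (Z j \<omega> - m j) * v j \<omega>) / (\<Sum>j<n. v j \<omega>)) \<longlonglongrightarrow> 0"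
  proof (rule FX.AE_weighted_average_tendsto_0[where c = k])
    fix n
    show "(\<lambda>\<omega>. (Z n \<omega> - m n) * v n \<omega>) \<in> borel_measurable (FX (Suc n))"
      using measurable_FN_FX[OF measurable_F_FN[OF Z_F[of n]]] FX.measurable_mono[OF _ v_meas[of n], of "Suc n"]
      by (intro borel_measurable_times borel_measurable_diff) auto
    show "AE \<omega> in M. 0 \<le> v n \<omega> \<and> v n \<omega> \<le> k"
      using v_bd[of n] by eventually_elim (use k in auto)
    show "AE \<omega> in M. \<bar>(Z n \<omega> - m n) * v n \<omega>\<bar> \<le> k"
      using Zm_bd[of n] v_bd[of n]
    proof eventually_elim
      case (elim \<omega>)
      have "\<bar>(Z n \<omega> - m n) * v n \<omega>\<bar> \<le> 2 * r * c"
        unfolding abs_mult using elim r0 by (intro mult_mono) auto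
      thus ?case using k by linarith
    qed
    fix U :: "'w \<Rightarrow> real" assume U: "U \<in> borel_measurable (FX n)"
    have Um[measurable]: "U \<in> borel_measurable M" using FX.measurable_M[OF U] .
    have Uv_int: "integrable M (\<lambda>\<omega>. U \<omega> * v n \<omega>)" if "integrable M U"
    proof (rule Bochner_Integration.integrable_bound)
      show "integrable M (\<lambda>\<omega>. c * U \<omega>)" using that by simp
      show "AE \<omega> in M. norm (U \<omega> * v n \<omega>) \<le> norm (c * U \<omega>)"
        using v_bd[of n] by eventually_elim (auto simp: abs_mult mult.commute[of c] intro!: mult_left_mono)
    qed measurable
    { assume Ui: "integrable M U"
      have "(\<integral>\<omega>. (Z n \<omega> - m n) * (U \<omega> * v n \<omega>) \<partial>M)
          = (\<integral>\<omega>. Z n \<omega> - m n \<partial>M) * (\<integral>\<omega>. U \<omega> * v n \<omega> \<partial>M)"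
      proof (rule integral_mult_indep_subalgebras[OF AB_indep[of n]])
        show "(\<lambda>\<omega>. Z n \<omega> - m n) \<in> borel_measurable (?AB n)" using Z_AB by measurable
        show "(\<lambda>\<omega>. U \<omega> * v n \<omega>) \<in> borel_measurable (FX n)" using U v_meas by measurable
      qed (use Z_int Uv_int[OF Ui] in auto)
      also have "(\<integral>\<omega>. Z n \<omega> - m n \<partial>M) = 0" using Z_int by (simp add: m_def prob_space)
      finally show "(\<integral>\<omega>. U \<omega> * ((Z n \<omega> - m n) * v n \<omega>) \<partial>M) = 0" by (simp add: mult_ac) }
    { assume U01: "AE \<omega> in M. 0 \<le> U \<omega> \<and> U \<omega> \<le> 1"
      have Ui: "integrable M U"
      proof (rule integrable_AE_bounded)
        show "AE \<omega> in M. \<bar>U \<omega>\<bar> \<le> 1" using U01 by eventually_elim simp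
      qed measurable
      have bd: "AE \<omega> in M. 0 \<le> U \<omega> * ((Z n \<omega> - m n) * v n \<omega>)\<^sup>2 \<and>
          U \<omega> * ((Z n \<omega> - m n) * v n \<omega>)\<^sup>2 \<le> k * (U \<omega> * v n \<omega>)"
        using U01 Zm_bd[of n] v_bd[of n]
      proof eventually_elim
        case (elim \<omega>)
        have "(Z n \<omega> - m n)\<^sup>2 \<le> (2 * r)\<^sup>2" using power_mono[OF elim(2), of 2] by simp
        \<comment> \<open>One factor \<open>v n\<close> of the square is bounded by
          \<open>c\<close>; the other is kept as the weight.\<close>
        hence "(Z n \<omega> - m n)\<^sup>2 * v n \<omega> \<le> (2 * r)\<^sup>2 * c" using elim by (intro mult_mono) auto
        hence "(Z n \<omega> - m n)\<^sup>2 * v n \<omega> \<le> k" using k by linarith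
        hence "((Z n \<omega> - m n)\<^sup>2 * v n \<omega>) * (U \<omega> * v n \<omega>) \<le> k * (U \<omega> * v n \<omega>)"
          using elim by (intro mult_right_mono) auto
        moreover have "((Z n \<omega> - m n)\<^sup>2 * v n \<omega>) * (U \<omega> * v n \<omega>) = U \<omega> * ((Z n \<omega> - m n) * v n \<omega>)\<^sup>2"
          by (simp add: power2_eq_square mult_ac)
        ultimately show ?case using elim by auto
      qed
      have i: "integrable M (\<lambda>\<omega>. k * (U \<omega> * v n \<omega>))" using Uv_int[OF Ui] by simp
      have "(\<integral>\<omega>. U \<omega> * ((Z n \<omega> - m n) * v n \<omega>)\<^sup>2 \<partial>M) \<le> (\<integral>\<omega>. k * (U \<omega> * v n \<omega>) \<partial>M)"
      proof (rule integral_mono_AE[OF _ i])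
        show "AE \<omega> in M. U \<omega> * ((Z n \<omega> - m n) * v n \<omega>)\<^sup>2 \<le> k * (U \<omega> * v n \<omega>)"
          using bd by eventually_elim simp
        show "integrable M (\<lambda>\<omega>. U \<omega> * ((Z n \<omega> - m n) * v n \<omega>)\<^sup>2)"
        proof (rule Bochner_Integration.integrable_bound[OF i])
          show "AE \<omega> in M. norm (U \<omega> * ((Z n \<omega> - m n) * v n \<omega>)\<^sup>2) \<le> norm (k * (U \<omega> * v n \<omega>))"
            using bd unfolding real_norm_def by eventually_elim linarith
        qed measurable
      qed
      thus "(\<integral>\<omega>. U \<omega> * ((Z n \<omega> - m n) * v n \<omega>)\<^sup>2 \<partial>M) \<le> k * (\<integral>\<omega>. U \<omega> * v n \<omega> \<partial>M)" by simp }
  qed (rule v_meas)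
  moreover have "AE \<omega> in M. \<forall>n. 0 \<le> v n \<omega>"
    unfolding AE_all_countable
  proof
    fix n show "AE \<omega> in M. 0 \<le> v n \<omega>" using v_bd[of n] by eventually_elim simp
  qed
  ultimately show ?thesis
  proof eventually_elim
    case (elim \<omega>)
    show ?case
    proof
      assume div: "filterlim (\<lambda>n. \<Sum>j<n. v j \<omega>) at_top sequentially"
      have "(\<lambda>n. (\<Sum>j<n. (Z j \<omega> - m j) * v j \<omega>) / (\<Sum>j<n. v j \<omega>)
              + (\<Sum>j<n. v j \<omega> * m j) / (\<Sum>j<n. v j \<omega>)) \<longlonglongrightarrow> 0 + q"
        using elim div by (intro tendsto_add weighted_cesaro m_lim) auto
      moreover have "(\<Sum>j<n. (Z j \<omega> - m j) * v j \<omega>) / (\<Sum>j<n. v j \<omega>) + (\<Sum>j<n. v j \<omega> * m j) / (\<Sum>j<n. v j \<omega>)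
          = (\<Sum>j<n. Z j \<omega> * v j \<omega>) / (\<Sum>j<n. v j \<omega>)" for n
        unfolding add_divide_distrib[symmetric] sum.distrib[symmetric]
        by (simp add: algebra_simps)
      ultimately show "(\<lambda>n. (\<Sum>j<n. f (A (Suc j) \<omega>) (B (Suc j) \<omega>) * v j \<omega>) / (\<Sum>j<n. v j \<omega>)) \<longlonglongrightarrow> q"
        by (simp add: Z_def)
    qed
  qed
qed

section \<open>Means weighted by the drawn colours\<close>

lemma AE_mean_drawn_A:
  assumes f_bd: "\<And>x y. x \<le> C \<Longrightarrow> y \<le> C \<Longrightarrow> \<bar>f x y\<bar> \<le> r"
    and lim: "(\<lambda>n. \<integral>\<omega>. f (A n \<omega>) (B n \<omega>) \<partial>M) \<longlonglongrightarrow> q"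
  shows "AE \<omega> in M. (\<lambda>n. (\<Sum>j=1..n. f (A j \<omega>) (B j \<omega>) * real (X j \<omega>)) / (\<Sum>j=1..n. real (X j \<omega>))) \<longlonglongrightarrow> q"
proof -
  have "AE \<omega> in M. filterlim (\<lambda>n. \<Sum>j<n. real (X (Suc j) \<omega>)) at_top sequentially \<longrightarrow>
    (\<lambda>n. (\<Sum>j<n. f (A (Suc j) \<omega>) (B (Suc j) \<omega>) * real (X (Suc j) \<omega>)) / (\<Sum>j<n. real (X (Suc j) \<omega>))) \<longlonglongrightarrow> q"
  proof (rule AE_weighted_mean_reinforcement[OF f_bd _ _ lim])
    fix n
    show "(\<lambda>\<omega>. real (X (Suc n) \<omega>)) \<in> borel_measurable (FX n)"
      by (rule measurable_FX_fun2[where f = "\<lambda>i j. real j"])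
    show "AE \<omega> in M. 0 \<le> real (X (Suc n) \<omega>) \<and> real (X (Suc n) \<omega>) \<le> real C"
      using AE_le_C AE_X_le_N by eventually_elim (auto intro: order_trans)
  qed
  thus ?thesis using AE_sum_X_at_top
    by eventually_elim (simp add: sum.atLeast1_atMost_eq)
qed

lemma AE_mean_drawn_B:
  assumes f_bd: "\<And>x y. x \<le> C \<Longrightarrow> y \<le> C \<Longrightarrow> \<bar>f x y\<bar> \<le> r"
    and lim: "(\<lambda>n. \<integral>\<omega>. f (A n \<omega>) (B n \<omega>) \<partial>M) \<longlonglongrightarrow> q"
  shows "AE \<omega> in M. (\<lambda>n. (\<Sum>j=1..n. f (A j \<omega>) (B j \<omega>) * (real (N j \<omega>) - real (X j \<omega>)))
      / (\<Sum>j=1..n. real (N j \<omega>) - real (X j \<omega>))) \<longlonglongrightarrow> q"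
proof -
  have "AE \<omega> in M. filterlim (\<lambda>n. \<Sum>j<n. real (N (Suc j) \<omega>) - real (X (Suc j) \<omega>)) at_top sequentially \<longrightarrow>
    (\<lambda>n. (\<Sum>j<n. f (A (Suc j) \<omega>) (B (Suc j) \<omega>) * (real (N (Suc j) \<omega>) - real (X (Suc j) \<omega>)))
      / (\<Sum>j<n. real (N (Suc j) \<omega>) - real (X (Suc j) \<omega>))) \<longlonglongrightarrow> q"
  proof (rule AE_weighted_mean_reinforcement[OF f_bd _ _ lim])
    fix n
    show "(\<lambda>\<omega>. real (N (Suc n) \<omega>) - real (X (Suc n) \<omega>)) \<in> borel_measurable (FX n)"
      by (rule measurable_FX_fun2[where f = "\<lambda>i j. real i - real j"])
    show "AE \<omega> in M. 0 \<le> real (N (Suc n) \<omega>) - real (X (Suc n) \<omega>) \<and> real (N (Suc n) \<omega>) - real (X (Suc n) \<omega>) \<le> real C"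
      using AE_le_C AE_X_le_N
    proof eventually_elim
      case (elim \<omega>)
      have "real (N (Suc n) \<omega>) \<le> real C" "real (X (Suc n) \<omega>) \<le> real (N (Suc n) \<omega>)" using elim by auto
      thus ?case by linarith
    qed
  qed
  thus ?thesis using AE_sum_N_minus_X_at_top
    by eventually_elim (simp only: One_nat_def sum.atLeast1_atMost_eq)
qed

text \<open>Divergence of the denominator is available only where the mean draw size has a limit
  above 1, hence the premise on \<open>l\<close> in place of an unconditional limit.\<close>

lemma AE_mean_drawn_product:
  assumes f_bd: "\<And>x y. x \<le> C \<Longrightarrow> y \<le> C \<Longrightarrow> \<bar>f x y\<bar> \<le> r"
    and lim: "(\<lambda>n. \<integral>\<omega>. f (A n \<omega>) (B n \<omega>) \<partial>M) \<longlonglongrightarrow> q"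
  shows "AE \<omega> in M. \<forall>l>1. (\<lambda>n. (\<Sum>j=1..n. real (N j \<omega>)) / real n) \<longlonglongrightarrow> l \<longrightarrow>
    (\<lambda>n. (\<Sum>j=1..n. f (A j \<omega>) (B j \<omega>) * (real (X j \<omega>) * (real (N j \<omega>) - real (X j \<omega>))))
      / (\<Sum>j=1..n. real (X j \<omega>) * (real (N j \<omega>) - real (X j \<omega>)))) \<longlonglongrightarrow> q"
proof -
  let ?v = "\<lambda>j \<omega>. real (X (Suc j) \<omega>) * (real (N (Suc j) \<omega>) - real (X (Suc j) \<omega>))"
  have "AE \<omega> in M. filterlim (\<lambda>n. \<Sum>j<n. ?v j \<omega>) at_top sequentially \<longrightarrow>
    (\<lambda>n. (\<Sum>j<n. f (A (Suc j) \<omega>) (B (Suc j) \<omega>) * ?v j \<omega>) / (\<Sum>j<n. ?v j \<omega>)) \<longlonglongrightarrow> q"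
  proof (rule AE_weighted_mean_reinforcement[OF f_bd _ _ lim])
    fix n
    show "?v n \<in> borel_measurable (FX n)"
      by (rule measurable_FX_fun2[where f = "\<lambda>i j. real j * (real i - real j)"])
    show "AE \<omega> in M. 0 \<le> ?v n \<omega> \<and> ?v n \<omega> \<le> real C * real C"
      using AE_le_C AE_X_le_N
    proof eventually_elim
      case (elim \<omega>)
      have "real (N (Suc n) \<omega>) \<le> real C" "real (X (Suc n) \<omega>) \<le> real (N (Suc n) \<omega>)" using elim by auto
      thus ?case by (auto intro!: mult_mono)
    qed
  qed
  thus ?thesis using AE_sum_product_at_top
    by eventually_elim (simp only: One_nat_def sum.atLeast1_atMost_eq, blast)
qed

end

section \<open>Strong consistency of the estimators\<close>

theorem corollary3p2:
  fixes M :: "'w measure"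
    and a b :: nat
    and N X A B :: "nat \<Rightarrow> 'w \<Rightarrow> nat"
    and mA mB :: real
    and Nlim Qlim :: "'w \<Rightarrow> real"
  assumes urn: "urn_model M a b N X A B"
    and mA: "(\<lambda>n. \<integral>\<omega>. real (A n \<omega>) \<partial>M) \<longlonglongrightarrow> mA"
    and mB: "(\<lambda>n. \<integral>\<omega>. real (B n \<omega>) \<partial>M) \<longlonglongrightarrow> mB"
    and cases: "urn_case_greater M A B mA mB \<or> urn_case_equal M A B"
    and Nlim_rv: "Nlim \<in> borel_measurable M" and Nlim_pos: "AE \<omega> in M. Nlim \<omega> > 0"
    and Qlim_rv: "Qlim \<in> borel_measurable M" and Qlim_pos: "AE \<omega> in M. Qlim \<omega> > 0"
    and N_lim: "AE \<omega> in M.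
      (\<lambda>n. real_cond_exp M (urn_F M N X A B n) (\<lambda>\<omega>. real (N (Suc n) \<omega>)) \<omega>) \<longlonglongrightarrow> Nlim \<omega>"
    and Q_lim: "AE \<omega> in M.
      (\<lambda>n. real_cond_exp M (urn_F M N X A B n) (\<lambda>\<omega>. (real (N (Suc n) \<omega>))\<^sup>2) \<omega>) \<longlonglongrightarrow> Qlim \<omega>"
  shows
    "((AE \<omega> in M. (\<lambda>n. (\<Sum>j=1..n. real (N j \<omega>)) / real n) \<longlonglongrightarrow> Nlim \<omega>) \<and>
      (AE \<omega> in M. (\<lambda>n. (\<Sum>j=1..n. (real (N j \<omega>))\<^sup>2) / real n) \<longlonglongrightarrow> Qlim \<omega>)) \<and>
     ((AE \<omega> in M. (\<lambda>n. (\<Sum>j=1..n. real (A j \<omega>) * real (X j \<omega>))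
                        / (\<Sum>j=1..n. real (X j \<omega>))) \<longlonglongrightarrow> mA) \<and>
      (AE \<omega> in M. (\<lambda>n. (\<Sum>j=1..n. real (B j \<omega>) * (real (N j \<omega>) - real (X j \<omega>)))
                        / (\<Sum>j=1..n. real (N j \<omega>) - real (X j \<omega>))) \<longlonglongrightarrow> mB)) \<and>
     (\<forall>qA qB.
       ((\<lambda>n. \<integral>\<omega>. (real (A n \<omega>))\<^sup>2 \<partial>M) \<longlonglongrightarrow> qA) \<and>
       ((\<lambda>n. \<integral>\<omega>. (real (B n \<omega>))\<^sup>2 \<partial>M) \<longlonglongrightarrow> qB) \<longrightarrow>
       (AE \<omega> in M. (\<lambda>n. (\<Sum>j=1..n. (real (A j \<omega>))\<^sup>2 * real (X j \<omega>))
                        / (\<Sum>j=1..n. real (X j \<omega>))) \<longlonglongrightarrow> qA) \<and>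
       (AE \<omega> in M. (\<lambda>n. (\<Sum>j=1..n. (real (B j \<omega>))\<^sup>2 * (real (N j \<omega>) - real (X j \<omega>)))
                        / (\<Sum>j=1..n. real (N j \<omega>) - real (X j \<omega>))) \<longlonglongrightarrow> qB)) \<and>
     (\<forall>qAB.
       ((\<lambda>n. \<integral>\<omega>. real (A n \<omega>) * real (B n \<omega>) \<partial>M) \<longlonglongrightarrow> qAB) \<and>
       measure M {\<omega> \<in> space M. Nlim \<omega> = 1} < 1 \<longrightarrow>
       (AE \<omega> in M. Nlim \<omega> > 1 \<longrightarrow>
          (\<lambda>n. (\<Sum>j=1..n. real (A j \<omega>) * real (B j \<omega>) * real (X j \<omega>) * (real (N j \<omega>) - real (X j \<omega>)))
                / (\<Sum>j=1..n. real (X j \<omega>) * (real (N j \<omega>) - real (X j \<omega>)))) \<longlonglongrightarrow> qAB))"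
proof -
  interpret urn_model M a b N X A B by (rule urn)
  \<comment> \<open>The identity and, below, the square are at least 1 at positive draw sizes, as
    the averaging lemma asks.\<close>
  have mean: "AE \<omega> in M. (\<lambda>n. (\<Sum>j=1..n. real (N j \<omega>)) / real n) \<longlonglongrightarrow> Nlim \<omega>"
    using AE_average_tendsto_cond_exp_limit[of real "real C", OF _ N_lim]
    by (simp add: sum.atLeast1_atMost_eq)
  have square: "AE \<omega> in M. (\<lambda>n. (\<Sum>j=1..n. (real (N j \<omega>))\<^sup>2) / real n) \<longlonglongrightarrow> Qlim \<omega>"
    using AE_average_tendsto_cond_exp_limit[of "\<lambda>m. (real m)\<^sup>2" "(real C)\<^sup>2", OF _ Q_lim]
    by (simp add: sum.atLeast1_atMost_eq power_mono)
  show ?thesis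
  proof (intro conjI allI impI mean square)
    show "AE \<omega> in M. (\<lambda>n. (\<Sum>j=1..n. real (A j \<omega>) * real (X j \<omega>)) / (\<Sum>j=1..n. real (X j \<omega>))) \<longlonglongrightarrow> mA"
      by (rule AE_mean_drawn_A[where f = "\<lambda>x y. real x" and r = "real C"]) (use mA in auto)
    show "AE \<omega> in M. (\<lambda>n. (\<Sum>j=1..n. real (B j \<omega>) * (real (N j \<omega>) - real (X j \<omega>)))
                        / (\<Sum>j=1..n. real (N j \<omega>) - real (X j \<omega>))) \<longlonglongrightarrow> mB"
      by (rule AE_mean_drawn_B[where f = "\<lambda>x y. real y" and r = "real C"]) (use mB in auto)
  next
    fix qA qB
    assume q: "((\<lambda>n. \<integral>\<omega>. (real (A n \<omega>))\<^sup>2 \<partial>M) \<longlonglongrightarrow> qA) \<and>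
       ((\<lambda>n. \<integral>\<omega>. (real (B n \<omega>))\<^sup>2 \<partial>M) \<longlonglongrightarrow> qB)"
    show "AE \<omega> in M. (\<lambda>n. (\<Sum>j=1..n. (real (A j \<omega>))\<^sup>2 * real (X j \<omega>))
                        / (\<Sum>j=1..n. real (X j \<omega>))) \<longlonglongrightarrow> qA"
      by (rule AE_mean_drawn_A[where f = "\<lambda>x y. (real x)\<^sup>2" and r = "(real C)\<^sup>2"])
         (use q in \<open>auto intro: power_mono\<close>)
    show "AE \<omega> in M. (\<lambda>n. (\<Sum>j=1..n. (real (B j \<omega>))\<^sup>2 * (real (N j \<omega>) - real (X j \<omega>)))
                        / (\<Sum>j=1..n. real (N j \<omega>) - real (X j \<omega>))) \<longlonglongrightarrow> qB"
      by (rule AE_mean_drawn_B[where f = "\<lambda>x y. (real y)\<^sup>2" and r = "(real C)\<^sup>2"])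
         (use q in \<open>auto intro: power_mono\<close>)
  next
    fix qAB
    assume q: "((\<lambda>n. \<integral>\<omega>. real (A n \<omega>) * real (B n \<omega>) \<partial>M) \<longlonglongrightarrow> qAB) \<and>
       measure M {\<omega> \<in> space M. Nlim \<omega> = 1} < 1"
    have "AE \<omega> in M. \<forall>l>1. (\<lambda>n. (\<Sum>j=1..n. real (N j \<omega>)) / real n) \<longlonglongrightarrow> l \<longrightarrow>
      (\<lambda>n. (\<Sum>j=1..n. real (A j \<omega>) * real (B j \<omega>) * (real (X j \<omega>) * (real (N j \<omega>) - real (X j \<omega>))))
        / (\<Sum>j=1..n. real (X j \<omega>) * (real (N j \<omega>) - real (X j \<omega>)))) \<longlonglongrightarrow> qAB"
      by (rule AE_mean_drawn_product[where f = "\<lambda>x y. real x * real y" and r = "real C * real C"])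
         (use q in \<open>auto simp: abs_mult intro: mult_mono\<close>)
    \<comment> \<open>\<open>l\<close> is instantiated path by path with
      \<open>Nlim \<omega>\<close>, the limit that \<open>mean\<close> supplies.\<close>
    thus "AE \<omega> in M. Nlim \<omega> > 1 \<longrightarrow>
          (\<lambda>n. (\<Sum>j=1..n. real (A j \<omega>) * real (B j \<omega>) * real (X j \<omega>) * (real (N j \<omega>) - real (X j \<omega>)))
                / (\<Sum>j=1..n. real (X j \<omega>) * (real (N j \<omega>) - real (X j \<omega>)))) \<longlonglongrightarrow> qAB"
      using mean by eventually_elim (simp add: mult.assoc)
  qed
qed

end
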